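(* Let $n\geq 3$ and let $\Omega\subset\mathbb{R}^n$ be a bounded simple rotationally symmetric domain along the $x_n$ axis. Let $f(x,u)\in C^{1,1}(\Omega,\mathbb{R})$ be a function which is convex with respect to $u$, satisfies $f(x',x_n,u)=f(x',-x_n,u)$ and $f(x',x_n,u)=f(|x'|,x_n,u)$ where $x'=(x_1,\dots,x_{n-1})$, and is decreasing in the $x_i$-variable for $x_i>0$ ($i=1,\dots,n$). Let $u$ be a positive stable solution of $$-\Delta u=f(x,u)\ \text{in}\ \Omega,\qquad u=0\ \text{on}\ \partial\Omega.$$ Then: (1) $u$ is rotationally symmetric with respect to the $x_n$ axis; (2) $u_{x_n}<0$ for $x_n>0$; (3) $x_iu_{x_i}<0$ for $x_i\neq 0$, $i=1,2,\dots,n-1$; (4) $\frac{\partial u(r,x_n)}{\partial r}<0$ for $r\neq 0$, where $r=|x'|$, $x'=(x_1,\dots,x_{n-1})$; (5) $u$ has a unique critical point $p$ in $\Omega$, and $p$ is a non-degenerate maximum point.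
   Context: A domain $\Omega$ is $x_i$-convex if for any two points $P,Q\in\Omega$ such that the segment $\overline{PQ}$ is parallel to the $x_i$ axis, one has $\overline{PQ}\subset\Omega$. A domain $\Omega\subset\mathbb{R}^n$ is simple rotationally symmetric along the $x_n$ axis if (1) it is symmetric with respect to the hyperplane $x_n=0$; (2) it is invariant under every orthogonal transformation $A\in O(n)$ fixing the $x_n$ axis; (3) it is $x_i$-convex for every $i=1,\dots,n$. A solution $u$ of $-\Delta u=f(x,u)$ in $\Omega$, $u=0$ on $\partial\Omega$, is stable if the linearized operator $\mathfrak{L}=-\Delta-f'(x,u)$ (where $f'$ denotes the derivative of $f$ with respect to $u$) satisfies $\int_\Omega|\nabla\phi|^2dx-\int_\Omega f'(x,u)\phi^2dx>0$ for every nonzero $\phi\in H^1_0(\Omega)$; equivalently, the first Dirichlet eigenvalue of $\mathfrak{L}$ in $\Omega$ is positive. A critical point is non-degenerate if the Hessian of $u$ there has nonzero determinant. *)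

theory Defs
  imports "HOL-Analysis.Analysis"
begin

definition dderiv :: "('a::real_normed_vector \<Rightarrow> real) \<Rightarrow> 'a \<Rightarrow> 'a \<Rightarrow> real" where
  "dderiv g v x = deriv (\<lambda>t. g (x + t *\<^sub>R v)) 0"

definition partial :: "'n::finite \<Rightarrow> (real^'n \<Rightarrow> real) \<Rightarrow> real^'n \<Rightarrow> real" where
  "partial i g x = dderiv g (axis i 1) x"

definition laplacian :: "(real^'n::finite \<Rightarrow> real) \<Rightarrow> real^'n \<Rightarrow> real" where
  "laplacian g x = (\<Sum>i\<in>UNIV. partial i (partial i g) x)"

definition hessian :: "(real^'n::finite \<Rightarrow> real) \<Rightarrow> real^'n \<Rightarrow> real^'n^'n" where
  "hessian g x = (\<chi> i j. partial i (partial j g) x)"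

definition grad_sq :: "(real^'n::finite \<Rightarrow> real) \<Rightarrow> real^'n \<Rightarrow> real" where
  "grad_sq g x = (\<Sum>i\<in>UNIV. (partial i g x)^2)"

definition C1_on :: "'a::euclidean_space set \<Rightarrow> ('a \<Rightarrow> real) \<Rightarrow> bool" where
  "C1_on S g \<longleftrightarrow> (\<forall>x\<in>S. g differentiable (at x)) \<and>
                   (\<forall>b\<in>Basis. continuous_on S (dderiv g b))"

definition C2_on :: "'a::euclidean_space set \<Rightarrow> ('a \<Rightarrow> real) \<Rightarrow> bool" where
  "C2_on S g \<longleftrightarrow> C1_on S g \<and> (\<forall>b\<in>Basis. C1_on S (dderiv g b))"

definition C11_on :: "'a::euclidean_space set \<Rightarrow> ('a \<Rightarrow> real) \<Rightarrow> bool" where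
  "C11_on S g \<longleftrightarrow> C1_on S g \<and>
     (\<forall>b\<in>Basis. \<forall>K. compact K \<and> K \<subseteq> S \<longrightarrow> (\<exists>L. L-lipschitz_on K (dderiv g b)))"

definition xprime :: "'n::finite \<Rightarrow> real^'n \<Rightarrow> real^'n" where
  "xprime k x = x - (x $ k) *\<^sub>R axis k 1"

definition reflect :: "'n::finite \<Rightarrow> real^'n \<Rightarrow> real^'n" where
  "reflect k x = x - (2 * x $ k) *\<^sub>R axis k 1"

definition domain :: "'a::real_normed_vector set \<Rightarrow> bool" where
  "domain \<Omega> \<longleftrightarrow> open \<Omega> \<and> connected \<Omega> \<and> \<Omega> \<noteq> {}"

definition axis_convex :: "'n::finite \<Rightarrow> (real^'n) set \<Rightarrow> bool" where
  "axis_convex i \<Omega> \<longleftrightarrow>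
     (\<forall>P\<in>\<Omega>. \<forall>Q\<in>\<Omega>. (\<exists>c. Q - P = c *\<^sub>R axis i 1) \<longrightarrow> closed_segment P Q \<subseteq> \<Omega>)"

definition simple_rot_sym :: "'n::finite \<Rightarrow> (real^'n) set \<Rightarrow> bool" where
  "simple_rot_sym k \<Omega> \<longleftrightarrow>
     (\<forall>x\<in>\<Omega>. reflect k x \<in> \<Omega>) \<and>
     (\<forall>A::real^'n^'n. orthogonal_matrix A \<and> A *v axis k 1 = axis k 1 \<longrightarrow>
         (\<forall>x\<in>\<Omega>. A *v x \<in> \<Omega>)) \<and>
     (\<forall>i. axis_convex i \<Omega>)"

(* stability: first Dirichlet eigenvalue of -\<Delta> - f'(x,u) positive, via the
   Rayleigh quotient over C^1 test functions with compact support in \<Omega> *)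
definition stable :: "(real^'n::finite) set \<Rightarrow> (real^'n \<Rightarrow> real \<Rightarrow> real) \<Rightarrow> (real^'n \<Rightarrow> real) \<Rightarrow> bool" where
  "stable \<Omega> f u \<longleftrightarrow>
     (\<exists>c>0. \<forall>\<phi>. C1_on UNIV \<phi> \<and> compact (closure {x. \<phi> x \<noteq> 0}) \<and>
                 closure {x. \<phi> x \<noteq> 0} \<subseteq> \<Omega> \<longrightarrow>
        integral \<Omega> (\<lambda>x. grad_sq \<phi> x - deriv (f x) (u x) * (\<phi> x)^2)
          \<ge> c * integral \<Omega> (\<lambda>x. (\<phi> x)^2))"

end

theory Submission
  imports Defs
begin

text \<open>
  For an affine isometry \<open>T\<close> with \<open>f (T x) s \<ge> f x s\<close>, convexity shows that \<open>w = u - u \<circ> T\<close> satisfies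
  \<open>- \<Delta>w \<le> f' w\<close>, and stability yields \<open>w \<le> 0\<close> by testing with the positive part of \<open>w\<close>. No regularity of
  \<open>\<Omega>\<close>, and no bound on \<open>f'\<close> up to the boundary, is available; therefore one tests with the positive part of
  \<open>w - \<epsilon> (S - u)\<close> for a constant \<open>S\<close> above \<open>u\<close>, which is compactly supported because \<open>w \<le> 0\<close> on the boundary, and
  \<open>S - u\<close> is a supersolution up to a constant since \<open>- \<Delta>(S - u) - f' (S - u) \<ge> - f x S \<ge> - f 0 S\<close>.
  Orthogonal \<open>T\<close> give the rotational symmetry. Reflections in the hyperplanes \<open>x\<^sub>i = \<mu>\<close> give monotonicity in
  \<open>x\<^sub>i\<close> for each \<open>\<mu> \<ge> 0\<close> separately, without a continuity argument in \<open>\<mu>\<close>. The Hopf lemma and the strong maximum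
  principle make it strict, so the origin is the only critical point. There the mixed second
  derivatives vanish by symmetry, and the pure ones are negative by the Hopf lemma applied at
  \<open>x\<^sub>i = \<mu>\<close> with constants linear in \<open>\<mu>\<close> as \<open>\<mu> \<rightarrow> 0\<close>; this uses only that \<open>u\<close> is \<open>C\<^sup>2\<close>.
\<close>

section \<open>Calculus with the partial derivatives\<close>

text \<open>Put w = u - u o T and let q x be the derivative of f x at u x. The tangent of f x at u x
  lies below f x, so f x (u x) - f x (u (T x)) \<le> q w whatever the sign of w: convexity yields
  exactly the potential in the stability condition. Working on a part D of \<Omega> is harmless,
  since test functions supported in D extend by zero. Admissible test functions are C^1, so the
  positive part is smoothed at a scale \<delta>. The smoothing error carries the maximum of |q| over
  the support, which grows as \<epsilon> shrinks. Hence the order of choice: a lower bound for the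
  L^2 mass, then \<epsilon>, then \<delta>. Stability alone gives only weak inequalities. Strictness
  comes from the boundary: for \<mu> > 0 the reflection carries the exit point of a ray back into
  \<Omega>, where u > 0. At \<mu> = 0 the difference is identically zero by symmetry, so this
  argument stops there. Differentiating the equation to study the derivatives of u would require
  third derivatives; a difference quotient in \<mu> is used at the origin instead.\<close>

definition grad :: "(real^'n::finite \<Rightarrow> real) \<Rightarrow> real^'n \<Rightarrow> real^'n" where
  "grad g x = (\<chi> i. partial i g x)"

lemma partial_dderiv: "partial i g = dderiv g (axis i 1)"
  by (auto simp: partial_def)

lemma line_deriv:
  assumes "(g has_derivative g') (at (x + s *\<^sub>R v))"
  shows "((\<lambda>t. g (x + t *\<^sub>R v)) has_real_derivative g' v) (at s)"
proof -
  have "((\<lambda>t. x + t *\<^sub>R v) has_derivative (\<lambda>t. t *\<^sub>R v)) (at s)"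
    by (auto intro!: derivative_eq_intros)
  from has_derivative_compose[OF this assms]
  have "((\<lambda>t. g (x + t *\<^sub>R v)) has_derivative (\<lambda>t. g' (t *\<^sub>R v))) (at s)" .
  moreover have "g' (t *\<^sub>R v) = g' v * t" for t
    using linear_scale[OF has_derivative_linear[OF assms], of t v] by simp
  ultimately show ?thesis by (simp add: has_field_derivative_def)
qed

lemma dderiv_eq:
  assumes "(g has_derivative g') (at x)"
  shows "dderiv g v x = g' v"
  using line_deriv[of g g' x 0 v] assms by (simp add: dderiv_def DERIV_imp_deriv)

lemma has_derivative_grad:
  assumes "(g has_derivative (\<lambda>h. G \<bullet> h)) (at x)"
  shows "grad g x = G" "partial i g x = G $ i"
proof -
  show "partial i g x = G $ i" for i
    using dderiv_eq[OF assms, of "axis i 1"] by (simp add: partial_dderiv inner_axis)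
  then show "grad g x = G" by (simp add: grad_def vec_eq_iff)
qed

lemma differentiable_grad:
  assumes "g differentiable (at x)"
  shows "(g has_derivative (\<lambda>h. grad g x \<bullet> h)) (at x)"
proof -
  obtain g' where g': "(g has_derivative g') (at x)"
    using assms by (auto simp: differentiable_def)
  have "g' h = grad g x \<bullet> h" for h
  proof -
    have "g' h = g' (\<Sum>i\<in>UNIV. (h $ i) *\<^sub>R axis i 1)"
      using basis_expansion[of h] by (simp add: scalar_mult_eq_scaleR)
    also have "\<dots> = (\<Sum>i\<in>UNIV. (h $ i) * g' (axis i 1))"
      using has_derivative_linear[OF g'] by (simp add: linear_sum linear_scale o_def)
    also have "\<dots> = grad g x \<bullet> h"
      by (simp add: inner_vec_def grad_def partial_dderiv dderiv_eq[OF g'] mult.commute)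
    finally show ?thesis .
  qed
  then have "g' = (\<lambda>h. grad g x \<bullet> h)" by auto
  then show ?thesis using g' by simp
qed

lemma C1_on_deriv:
  assumes "C1_on S g" "x \<in> S"
  shows "(g has_derivative (\<lambda>h. grad g x \<bullet> h)) (at x)"
  using assms by (auto simp: C1_on_def intro: differentiable_grad)

lemma C1_on_partial:
  fixes g :: "real^'n::finite \<Rightarrow> real"
  assumes "C1_on S g" shows "continuous_on S (partial i g)"
  using assms by (auto simp: C1_on_def partial_dderiv axis_in_Basis_iff)

lemma C1_on_cont: "C1_on S g \<Longrightarrow> continuous_on S g"
  by (auto simp: C1_on_def intro!: continuous_at_imp_continuous_on differentiable_imp_continuous_within)

lemma C1_onI:
  fixes g :: "real^'n::finite \<Rightarrow> real"
  assumes d: "\<And>x. x \<in> S \<Longrightarrow> (g has_derivative (\<lambda>h. G x \<bullet> h)) (at x)"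
    and c: "\<And>i. continuous_on S (\<lambda>x. G x $ i)"
  shows "C1_on S g"
  unfolding C1_on_def
proof (intro conjI ballI)
  show "g differentiable (at x)" if "x \<in> S" for x
    using d[OF that] by (auto simp: differentiable_def)
  fix b :: "real^'n" assume "b \<in> Basis"
  then obtain i where "b = axis i 1" by (auto simp: Basis_vec_def)
  then show "continuous_on S (dderiv g b)"
    using c[of i] has_derivative_grad(2)[OF d] by (auto simp: partial_dderiv cong: continuous_on_cong)
qed

lemma C2_onD:
  fixes g :: "real^'n::finite \<Rightarrow> real"
  assumes "C2_on S g" shows "C1_on S g" "C1_on S (partial i g)"
  using assms by (auto simp: C2_on_def partial_dderiv axis_in_Basis_iff)

lemma C2_onI:
  fixes g :: "real^'n::finite \<Rightarrow> real"
  assumes "C1_on S g" "\<And>i. C1_on S (partial i g)"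
  shows "C2_on S g"
  unfolding C2_on_def
proof (intro conjI ballI)
  fix b :: "real^'n" assume "b \<in> Basis"
  then obtain i where "b = axis i 1" by (auto simp: Basis_vec_def)
  then show "C1_on S (dderiv g b)" using assms(2)[of i] by (simp add: partial_dderiv)
qed (rule assms)

lemma C1_on_subset: "C1_on S g \<Longrightarrow> T \<subseteq> S \<Longrightarrow> C1_on T g"
  unfolding C1_on_def by (blast intro: continuous_on_subset)

lemma C2_on_subset: "C2_on S g \<Longrightarrow> T \<subseteq> S \<Longrightarrow> C2_on T g"
  unfolding C2_on_def by (blast intro: C1_on_subset)

lemma has_derivative_cong_open:
  assumes "open S" "x \<in> S" "\<And>y. y \<in> S \<Longrightarrow> g y = h y" "(h has_derivative h') (at x)"
  shows "(g has_derivative h') (at x)"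
  by (rule has_derivative_transform_within_open[OF assms(4,1,2)]) (simp add: assms(3))

lemma C1_on_cong:
  fixes g :: "real^'n::finite \<Rightarrow> real"
  assumes "open S" "\<forall>y\<in>S. g y = h y" "C1_on S h"
  shows "C1_on S g" "x \<in> S \<Longrightarrow> partial i g x = partial i h x"
proof -
  have *: "(g has_derivative (\<lambda>k. grad h x \<bullet> k)) (at x)" if "x \<in> S" for x
    using has_derivative_cong_open[OF assms(1) that _ C1_on_deriv[OF assms(3) that]] assms(2) by blast
  show "C1_on S g"
    using C1_on_partial[OF assms(3)] by (intro C1_onI[OF *]) (auto simp: grad_def)
  show "x \<in> S \<Longrightarrow> partial i g x = partial i h x"
    using has_derivative_grad(2)[OF *] by (simp add: grad_def)
qed

lemma C1_on_lincomb:
  fixes g h :: "real^'n::finite \<Rightarrow> real"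
  assumes "C1_on S g" "C1_on S h"
  shows "C1_on S (\<lambda>x. a * g x + b * h x + c)"
    "x \<in> S \<Longrightarrow> partial i (\<lambda>x. a * g x + b * h x + c) x = a * partial i g x + b * partial i h x"
proof -
  have *: "((\<lambda>x. a * g x + b * h x + c) has_derivative (\<lambda>k. (a *\<^sub>R grad g x + b *\<^sub>R grad h x) \<bullet> k)) (at x)"
    if "x \<in> S" for x
    using C1_on_deriv[OF assms(1) that] C1_on_deriv[OF assms(2) that]
    by (auto intro!: derivative_eq_intros simp: inner_simps)
  show "C1_on S (\<lambda>x. a * g x + b * h x + c)"
    using assms[THEN C1_on_partial] by (intro C1_onI[OF *]) (auto simp: grad_def intro!: continuous_intros)
  show "x \<in> S \<Longrightarrow> partial i (\<lambda>x. a * g x + b * h x + c) x = a * partial i g x + b * partial i h x"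
    using has_derivative_grad(2)[OF *] by (simp add: grad_def)
qed

lemma C2_on_lincomb:
  fixes g h :: "real^'n::finite \<Rightarrow> real"
  assumes "open S" "C2_on S g" "C2_on S h"
  shows "C2_on S (\<lambda>x. a * g x + b * h x + c)"
    "x \<in> S \<Longrightarrow> laplacian (\<lambda>x. a * g x + b * h x + c) x = a * laplacian g x + b * laplacian h x"
proof -
  note C = C2_onD[OF assms(2)] C2_onD[OF assms(3)]
  note L = C1_on_lincomb[OF C(1,3), where a = a and b = b and c = c]
  have P: "\<forall>x\<in>S. partial i (\<lambda>x. a * g x + b * h x + c) x = a * partial i g x + b * partial i h x + 0"
    for i using L(2) by simp
  note Q = C1_on_cong[OF assms(1) P C1_on_lincomb(1)[OF C(2,4)]]
  show "C2_on S (\<lambda>x. a * g x + b * h x + c)"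
    by (rule C2_onI[OF L(1) Q(1)])
  show "laplacian (\<lambda>x. a * g x + b * h x + c) x = a * laplacian g x + b * laplacian h x" if "x \<in> S"
    unfolding laplacian_def
    by (simp only: Q(2)[OF that] C1_on_lincomb(2)[OF C(2,4) that] sum.distrib sum_distrib_left)
qed

lemma C1_on_affine:
  fixes g :: "real^'n::finite \<Rightarrow> real" and A :: "real^'n^'n" and b :: "real^'n"
  assumes "C1_on S g"
  defines "T \<equiv> \<lambda>x. A *v x + b"
  assumes D: "T ` D \<subseteq> S"
  shows "C1_on D (\<lambda>x. g (T x))"
    "x \<in> D \<Longrightarrow> partial i (\<lambda>x. g (T x)) x = (\<Sum>j\<in>UNIV. A$j$i * partial j g (T x))"
proof -
  have T: "(T has_derivative (\<lambda>h. A *v h)) (at x)" for x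
    unfolding T_def by (auto intro!: derivative_eq_intros bounded_linear_imp_has_derivative)
  have *: "((\<lambda>x. g (T x)) has_derivative (\<lambda>h. (transpose A *v grad g (T x)) \<bullet> h)) (at x)"
    if "x \<in> D" for x
    using has_derivative_compose[OF T C1_on_deriv[OF assms(1)], of x] D that
    by (auto simp: dot_lmul_matrix)
  have e: "(transpose A *v grad g (T x)) $ i = (\<Sum>j\<in>UNIV. A$j$i * partial j g (T x))" for x i
    by (simp add: matrix_vector_mult_def transpose_def grad_def)
  have cT: "continuous_on X T" for X unfolding T_def
    by (auto intro!: continuous_intros)
  show "C1_on D (\<lambda>x. g (T x))"
    by (intro C1_onI[OF *], assumption, unfold e)
      (intro continuous_intros continuous_on_compose2[OF C1_on_partial[OF assms(1)] cT] continuous_on_subset[OF _ subset_UNIV] D)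
  show "partial i (\<lambda>x. g (T x)) x = (\<Sum>j\<in>UNIV. A$j$i * partial j g (T x))" if "x \<in> D"
    using has_derivative_grad(2)[OF *[OF that], of i] unfolding e .
qed

lemma C1_on_sum:
  fixes g :: "'j \<Rightarrow> real^'n::finite \<Rightarrow> real"
  assumes "finite J" "\<And>j. C1_on S (g j)"
  shows "C1_on S (\<lambda>x. \<Sum>j\<in>J. c j * g j x) \<and>
    (\<forall>x\<in>S. partial i (\<lambda>x. \<Sum>j\<in>J. c j * g j x) x = (\<Sum>j\<in>J. c j * partial i (g j) x))"
proof -
  have *: "((\<lambda>x. \<Sum>j\<in>J. c j * g j x) has_derivative (\<lambda>k. (\<Sum>j\<in>J. c j *\<^sub>R grad (g j) x) \<bullet> k)) (at x)"
    if "x \<in> S" for x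
    using C1_on_deriv[OF assms(2) that]
    by (auto intro!: derivative_eq_intros simp: inner_sum_left)
  have "C1_on S (\<lambda>x. \<Sum>j\<in>J. c j * g j x)"
    using assms(2)[THEN C1_on_partial]
    by (intro C1_onI[OF *]) (auto simp: grad_def intro!: continuous_intros)
  moreover have "partial i (\<lambda>x. \<Sum>j\<in>J. c j * g j x) x = (\<Sum>j\<in>J. c j * partial i (g j) x)" if "x \<in> S" for x
    using has_derivative_grad(2)[OF *[OF that]] by (simp add: grad_def)
  ultimately show ?thesis by blast
qed

text \<open>The chain rule contracts the second derivatives of g with \<open>A$j$i * A$l$i\<close>.
  Summing over i produces the entries of \<open>A ** transpose A\<close>, the identity, so only the
  trace survives.\<close>

lemma C2_on_isometry:
  fixes g :: "real^'n::finite \<Rightarrow> real" and A :: "real^'n^'n" and b :: "real^'n"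
  assumes g: "C2_on S g" and A: "orthogonal_matrix A" and "open D"
  defines "T \<equiv> \<lambda>x. A *v x + b"
  assumes D: "T ` D \<subseteq> S"
  shows "C2_on D (\<lambda>x. g (T x))"
    "x \<in> D \<Longrightarrow> laplacian (\<lambda>x. g (T x)) x = laplacian g (T x)"
proof -
  note D' = D[unfolded T_def]
  note L = C1_on_affine[OF C2_onD(1)[OF g] D', folded T_def]
  note M = C1_on_affine[OF C2_onD(2)[OF g] D', folded T_def]
  define s where "s i x = (\<Sum>j\<in>UNIV. A$j$i * partial j g (T x))" for i x
  have s: "C1_on D (s i)" "x \<in> D \<Longrightarrow> partial i' (s i) x = (\<Sum>j\<in>UNIV. A$j$i * (\<Sum>l\<in>UNIV. A$l$i' * partial l (partial j g) (T x)))"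
    for i i' x
    using C1_on_sum[of UNIV D "\<lambda>j x. partial j g (T x)" "\<lambda>j. A$j$i" i'] M
    unfolding s_def T_def by simp_all
  have P: "\<forall>x\<in>D. partial i (\<lambda>x. g (T x)) x = s i x" for i
    using L(2) by (simp add: s_def T_def)
  note Q = C1_on_cong[OF \<open>open D\<close> P s(1)]
  show "C2_on D (\<lambda>x. g (T x))"
    using C2_onI[OF L(1)] Q(1) by (simp add: T_def)
  have I: "(\<Sum>i\<in>UNIV. A$j$i * A$l$i) = (if j = l then 1 else 0)" for j l
  proof -
    have "(A ** transpose A) $ j $ l = mat 1 $ j $ l" using A by (simp add: orthogonal_matrix_def)
    then show ?thesis by (simp add: matrix_matrix_mult_def transpose_def mat_def)
  qed
  show "laplacian (\<lambda>x. g (T x)) x = laplacian g (T x)" if "x \<in> D"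
  proof -
    have "laplacian (\<lambda>x. g (T x)) x = (\<Sum>i\<in>UNIV. \<Sum>j\<in>UNIV. \<Sum>l\<in>UNIV. A$j$i * A$l$i * partial l (partial j g) (T x))"
      unfolding laplacian_def by (simp add: Q(2)[OF that] s(2)[OF that] sum_distrib_left mult.assoc)
    also have "\<dots> = (\<Sum>j\<in>UNIV. \<Sum>l\<in>UNIV. \<Sum>i\<in>UNIV. A$j$i * A$l$i * partial l (partial j g) (T x))"
      by (subst sum.swap, rule sum.cong[OF refl], subst sum.swap, rule refl)
    also have "\<dots> = (\<Sum>j\<in>UNIV. \<Sum>l\<in>UNIV. (if j = l then 1 else 0) * partial l (partial j g) (T x))"
      by (simp only: sum_distrib_right[symmetric] I)
    also have "\<dots> = laplacian g (T x)"
      by (simp add: laplacian_def if_distrib[of "\<lambda>z. z * _"] cong: if_cong)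
    finally show ?thesis .
  qed
qed

section \<open>Hopf lemma and strong maximum principle\<close>

text \<open>At the maximum g' vanishes. If l were positive, g' would be positive just to the right
  of 0 and g would exceed g 0 there; differentiability of g' at the single point 0 suffices.\<close>

lemma second_derivative_local_max:
  fixes g :: "real \<Rightarrow> real"
  assumes "d > 0" and g: "\<And>t. \<bar>t\<bar> < d \<Longrightarrow> (g has_real_derivative g' t) (at t)"
    and g': "(g' has_real_derivative l) (at 0)" and m: "\<And>t. \<bar>t\<bar> < d \<Longrightarrow> g t \<le> g 0"
  shows "l \<le> 0"
proof (rule ccontr)
  assume "\<not> l \<le> 0"
  then obtain e where e: "e > 0" "\<And>h. h > 0 \<Longrightarrow> h < e \<Longrightarrow> g' 0 < g' h"
    using DERIV_pos_inc_right[OF g'] by auto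
  have 0: "g' 0 = 0"
    using DERIV_local_max[OF g[of 0], of d] \<open>d > 0\<close> m by auto
  define t where "t = min d e / 2"
  have t: "0 < t" "t < d" "t < e" using \<open>d > 0\<close> \<open>e > 0\<close> by (auto simp: t_def)
  have "g 0 < g t"
  proof (rule DERIV_pos_imp_increasing_open[OF t(1)])
    show "\<exists>y. (g has_real_derivative y) (at x) \<and> 0 < y" if "0 < x" "x < t" for x
      using that t g[of x] e(2)[of x] 0 by auto
    show "continuous_on {0..t} g"
      using t by (auto intro!: continuous_at_imp_continuous_on DERIV_isCont[OF g])
  qed
  with m[of t] t show False by auto
qed

lemma derivative_le_at_0:
  fixes g b :: "real \<Rightarrow> real"
  assumes "(g has_real_derivative g') (at 0)" "(b has_real_derivative b') (at 0)"
    and "g 0 = b 0" "d > 0" "\<And>t. 0 < t \<Longrightarrow> t < d \<Longrightarrow> g t \<le> b t"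
  shows "g' \<le> b'"
proof (rule ccontr)
  assume "\<not> g' \<le> b'"
  moreover have D: "((\<lambda>t. g t - b t) has_real_derivative (g' - b')) (at 0)"
    using assms by (auto intro!: derivative_eq_intros)
  ultimately obtain e where e: "e > 0" "\<And>h. h > 0 \<Longrightarrow> h < e \<Longrightarrow> g 0 - b 0 < g h - b h"
    using DERIV_pos_inc_right[OF D] by auto
  define t where "t = min d e / 2"
  have "0 < t" "t < d" "t < e" using \<open>d > 0\<close> \<open>e > 0\<close> by (auto simp: t_def)
  with e(2)[of t] assms(5)[of t] assms(3) show False by auto
qed

lemma partial_line:
  fixes g :: "real^'n::finite \<Rightarrow> real"
  assumes "C1_on S g" "x + s *\<^sub>R axis i 1 \<in> S"
  shows "((\<lambda>t. g (x + t *\<^sub>R axis i 1)) has_real_derivative partial i g (x + s *\<^sub>R axis i 1)) (at s)"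
  using line_deriv[OF C1_on_deriv[OF assms]] by (simp add: inner_axis grad_def)

lemma norm_add_axis_sq:
  fixes x :: "real^'n::finite"
  shows "(norm (x + t *\<^sub>R axis i 1))\<^sup>2 = (norm x)\<^sup>2 + 2 * t * x $ i + t\<^sup>2"
  unfolding power2_norm_eq_inner
  by (simp add: inner_simps inner_axis inner_axis' power2_eq_square algebra_simps)

lemma norm_sq_sum:
  fixes x :: "real^'n::finite"
  shows "(norm x)\<^sup>2 = (\<Sum>i\<in>UNIV. (x $ i)\<^sup>2)"
  unfolding power2_norm_eq_inner by (simp add: inner_vec_def power2_eq_square)

text \<open>The bound is explicit in \<open>m\<close> because the non-degeneracy argument applies it to a family of
  functions tending to zero.\<close>

lemma hopf:
  fixes w :: "real^'n::finite \<Rightarrow> real" and K R :: real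
  defines "\<alpha> \<equiv> (2 * CARD('n) + K + 1) / R\<^sup>2 + 1"
  assumes C2: "C2_on S w" and S: "open S" "cball y R \<subseteq> S" and "R > 0" "K \<ge> 0" "m > 0"
    and w0: "\<And>x. x \<in> cball y R \<Longrightarrow> w x \<le> 0"
    and lap: "\<And>x. x \<in> ball y R \<Longrightarrow> K * w x \<le> laplacian w x"
    and wm: "\<And>x. x \<in> cball y (R/2) \<Longrightarrow> w x \<le> - m"
    and x0: "dist y x0 = R" "w x0 = 0"
  shows "grad w x0 \<bullet> (y - x0) \<le> - m * (2 * \<alpha> * R\<^sup>2 * exp (- \<alpha> * R\<^sup>2))"
proof -
  have "\<alpha> \<ge> 1" using \<open>R > 0\<close> \<open>K \<ge> 0\<close> by (simp add: \<alpha>_def)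
  \<comment> \<open>This is what \<alpha> was chosen for: where |x - y| \<ge> R/2, the factor 4
    \<alpha>^2 |x - y|^2 - 2 \<alpha> n is at least \<alpha> (\<alpha> R^2 - 2 n) \<ge> K + 1, which
    beats K.\<close>
  have \<alpha>R: "\<alpha> * R\<^sup>2 \<ge> 2 * CARD('n) + K + 1"
    using \<open>R > 0\<close> by (simp add: \<alpha>_def field_simps)
  \<comment> \<open>The classical Hopf barrier: zero on the outer sphere of the annulus A and at
    most 1 everywhere, so m Z stays below the gap m on the inner sphere.\<close>
  define Z where "Z x = exp (- \<alpha> * (norm (x - y))\<^sup>2) - exp (- \<alpha> * R\<^sup>2)" for x
  define A where "A = cball y R - ball y (R/2)"
  have cA: "compact A" unfolding A_def by (simp add: compact_diff)
  have "x0 \<in> A" using x0 \<open>R > 0\<close> by (auto simp: A_def)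
  have cw: "continuous_on S w" using C1_on_cont C2_onD(1)[OF C2] by blast
  have "A \<subseteq> S" using S by (auto simp: A_def)
  have "continuous_on A (\<lambda>x. w x + m * Z x)"
    unfolding Z_def by (intro continuous_intros continuous_on_subset[OF cw \<open>A \<subseteq> S\<close>])
  then obtain p where p: "p \<in> A" and pmax: "\<And>x. x \<in> A \<Longrightarrow> w x + m * Z x \<le> w p + m * Z p"
    using continuous_attains_sup[OF cA] \<open>x0 \<in> A\<close> by blast
  \<comment> \<open>A positive maximum cannot lie on either sphere. At an interior maximum the
    Laplacian of w + m Z is nonpositive, while w > - m Z and the choice of \<alpha> make it
    positive.\<close>
  have "w p + m * Z p \<le> 0"
  proof (rule ccontr)
    assume pos: "\<not> w p + m * Z p \<le> 0"
    have "dist y p \<noteq> R"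
      using pos w0[of p] by (auto simp: Z_def dist_norm norm_minus_commute)
    moreover have "dist y p \<noteq> R / 2"
    proof
      assume "dist y p = R / 2"
      then have "w p \<le> - m" by (intro wm) auto
      moreover have "Z p \<le> 1"
      proof -
        have "exp (- \<alpha> * (norm (p - y))\<^sup>2) \<le> 1" using \<open>\<alpha> \<ge> 1\<close> by simp
        then show ?thesis using exp_gt_zero[of "- \<alpha> * R\<^sup>2"] unfolding Z_def by linarith
      qed
      then have "m * Z p \<le> m" using \<open>m > 0\<close> by simp
      ultimately show False using pos by linarith
    qed
    ultimately have pb: "dist y p < R" "R / 2 < dist y p" using p by (auto simp: A_def)
    then have "p \<in> ball y R - cball y (R/2)" by auto
    moreover have "open (ball y R - cball y (R/2))" by (simp add: open_Diff)
    ultimately obtain d where d: "d > 0" "ball p d \<subseteq> ball y R - cball y (R/2)"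
      by (meson openE)
    then have dA: "ball p d \<subseteq> A" by (auto simp: A_def)
    define E where "E = exp (- \<alpha> * (norm (p - y))\<^sup>2)"
    have second: "partial i (partial i w) p + m * (E * (4 * \<alpha>\<^sup>2 * ((p - y) $ i)\<^sup>2 - 2 * \<alpha>)) \<le> 0" for i
    proof (rule second_derivative_local_max[OF \<open>d > 0\<close>])
      let ?e = "axis i 1 :: real^'n"
      have in_b: "p + t *\<^sub>R ?e \<in> ball p d" if "\<bar>t\<bar> < d" for t
        using that by (simp add: dist_norm)
      define L where "L t = exp (- \<alpha> * ((norm (p - y))\<^sup>2 + 2 * t * (p - y) $ i + t\<^sup>2))" for t
      have ZL: "Z (p + t *\<^sub>R ?e) = L t - exp (- \<alpha> * R\<^sup>2)" for t
        using norm_add_axis_sq[of "p - y" t i] by (simp add: Z_def L_def diff_add_eq)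
      have L': "(L has_real_derivative L t * (- \<alpha> * (2 * (p - y) $ i + 2 * t))) (at t)" for t
        unfolding L_def by (auto intro!: derivative_eq_intros simp: algebra_simps)
      show "((\<lambda>t. w (p + t *\<^sub>R ?e) + m * Z (p + t *\<^sub>R ?e)) has_real_derivative
          partial i w (p + t *\<^sub>R ?e) + m * (L t * (- \<alpha> * (2 * (p - y) $ i + 2 * t)))) (at t)"
        if "\<bar>t\<bar> < d" for t
      proof -
        have "p + t *\<^sub>R ?e \<in> S" using in_b[OF that] dA \<open>A \<subseteq> S\<close> by blast
        from partial_line[OF C2_onD(1)[OF C2] this]
        show ?thesis unfolding ZL by (auto intro!: derivative_eq_intros L')
      qed
      show "((\<lambda>t. partial i w (p + t *\<^sub>R ?e) + m * (L t * (- \<alpha> * (2 * (p - y) $ i + 2 * t))))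
         has_real_derivative partial i (partial i w) p + m * (E * (4 * \<alpha>\<^sup>2 * ((p - y) $ i)\<^sup>2 - 2 * \<alpha>))) (at 0)"
        using partial_line[OF C2_onD(2)[OF C2], of p 0 i i] p \<open>A \<subseteq> S\<close>
        by (auto intro!: derivative_eq_intros L' simp: L_def E_def algebra_simps power2_eq_square)
      show "w (p + t *\<^sub>R ?e) + m * Z (p + t *\<^sub>R ?e) \<le> w (p + 0 *\<^sub>R ?e) + m * Z (p + 0 *\<^sub>R ?e)"
        if "\<bar>t\<bar> < d" for t
        using pmax[of "p + t *\<^sub>R ?e"] in_b[OF that] dA by auto
    qed
    have "laplacian w p + m * (E * (4 * \<alpha>\<^sup>2 * (norm (p - y))\<^sup>2 - 2 * \<alpha> * CARD('n))) \<le> 0"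
    proof -
      have "(\<Sum>i\<in>UNIV. partial i (partial i w) p + m * (E * (4 * \<alpha>\<^sup>2 * ((p - y) $ i)\<^sup>2 - 2 * \<alpha>))) \<le> 0"
        using second by (rule sum_nonpos)
      then show ?thesis
        by (simp add: laplacian_def norm_sq_sum sum.distrib sum_subtractf
            sum_distrib_left[symmetric] mult.assoc mult.commute[of "real CARD('n)"])
    qed
    moreover have "K * w p \<le> laplacian w p" using pb by (intro lap) auto
    moreover have "- K * m * Z p \<le> K * w p"
      using pos \<open>K \<ge> 0\<close> mult_left_mono[of "- m * Z p" "w p" K] by (simp add: algebra_simps)
    ultimately have "m * (E * (4 * \<alpha>\<^sup>2 * (norm (p - y))\<^sup>2 - 2 * \<alpha> * CARD('n))) \<le> K * m * Z p"
      by linarith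
    moreover have "K * m * Z p \<le> m * (E * K)"
      using \<open>K \<ge> 0\<close> \<open>m > 0\<close> by (simp add: Z_def E_def algebra_simps)
    moreover have "K < 4 * \<alpha>\<^sup>2 * (norm (p - y))\<^sup>2 - 2 * \<alpha> * CARD('n)"
    proof -
      have "R\<^sup>2 \<le> (2 * norm (p - y))\<^sup>2"
        using pb \<open>R > 0\<close> by (intro power_mono) (auto simp: dist_norm norm_minus_commute)
      then have "R\<^sup>2 \<le> 4 * (norm (p - y))\<^sup>2" by (simp add: power2_eq_square)
      then have "\<alpha>\<^sup>2 * R\<^sup>2 \<le> \<alpha>\<^sup>2 * (4 * (norm (p - y))\<^sup>2)" by (rule mult_left_mono) simp
      moreover have "\<alpha> * (\<alpha> * R\<^sup>2 - 2 * CARD('n)) \<ge> 1 * (K + 1)"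
        using \<open>\<alpha> \<ge> 1\<close> \<alpha>R \<open>K \<ge> 0\<close> by (intro mult_mono) auto
      ultimately show ?thesis by (simp add: power2_eq_square algebra_simps)
    qed
    then have "m * (E * K) < m * (E * (4 * \<alpha>\<^sup>2 * (norm (p - y))\<^sup>2 - 2 * \<alpha> * CARD('n)))"
      using \<open>m > 0\<close> by (simp add: E_def)
    ultimately show False by linarith
  qed
  then have bar: "w x \<le> - m * Z x" if "x \<in> A" for x using pmax[OF that] by simp
  show ?thesis
  proof (rule derivative_le_at_0)
    show "((\<lambda>t. w (x0 + t *\<^sub>R (y - x0))) has_real_derivative grad w x0 \<bullet> (y - x0)) (at 0)"
      using line_deriv[of w _ x0 0 "y - x0"] C1_on_deriv[OF C2_onD(1)[OF C2], of x0] \<open>x0 \<in> A\<close> \<open>A \<subseteq> S\<close>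
      by auto
    \<comment> \<open>On the segment from x0 to y the distance to y is (1 - t) R, so the barrier is
      explicit in t; t < 1/2 keeps the segment inside A.\<close>
    show "((\<lambda>t. - m * (exp (- \<alpha> * ((1 - t)\<^sup>2 * R\<^sup>2)) - exp (- \<alpha> * R\<^sup>2))) has_real_derivative
       - m * (2 * \<alpha> * R\<^sup>2 * exp (- \<alpha> * R\<^sup>2))) (at 0)"
      by (auto intro!: derivative_eq_intros)
    show "w (x0 + 0 *\<^sub>R (y - x0)) = - m * (exp (- \<alpha> * ((1 - 0)\<^sup>2 * R\<^sup>2)) - exp (- \<alpha> * R\<^sup>2))"
      using x0 by simp
    show "(1/2 :: real) > 0" by simp
    fix t :: real assume t: "0 < t" "t < 1 / 2"
    have "x0 + t *\<^sub>R (y - x0) - y = (1 - t) *\<^sub>R (x0 - y)" by (simp add: algebra_simps)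
    then have n: "norm (x0 + t *\<^sub>R (y - x0) - y) = (1 - t) * R"
      using x0 t by (simp add: dist_norm norm_minus_commute)
    have "R / 2 \<le> (1 - t) * R" "(1 - t) * R \<le> R" using t \<open>R > 0\<close> by (auto simp: field_simps)
    then have "x0 + t *\<^sub>R (y - x0) \<in> A"
      using n by (auto simp: A_def dist_norm norm_minus_commute)
    from bar[OF this]
    show "w (x0 + t *\<^sub>R (y - x0)) \<le> - m * (exp (- \<alpha> * ((1 - t)\<^sup>2 * R\<^sup>2)) - exp (- \<alpha> * R\<^sup>2))"
      by (simp only: Z_def n power_mult_distrib)
  qed
qed

text \<open>A bound K of |q| reduces this to \<open>hopf\<close>: as w \<le> 0, (K + q) w \<le> 0
  and so K w \<le> - q w \<le> \<open>laplacian w\<close>. The gap m is minus the maximum of w on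
  the half ball, positive by compactness.\<close>

lemma hopf_strict:
  fixes w :: "real^'n::finite \<Rightarrow> real"
  assumes C2: "C2_on S w" and S: "open S" "cball y R \<subseteq> S" and "R > 0"
    and q: "continuous_on (cball y R) q"
    and w0: "\<And>x. x \<in> cball y R \<Longrightarrow> w x \<le> 0" and neg: "\<And>x. x \<in> ball y R \<Longrightarrow> w x < 0"
    and lap: "\<And>x. x \<in> ball y R \<Longrightarrow> - laplacian w x \<le> q x * w x"
    and x0: "dist y x0 = R" "w x0 = 0"
  shows "grad w x0 \<bullet> (y - x0) < 0"
proof -
  obtain K where K: "\<And>x. x \<in> cball y R \<Longrightarrow> \<bar>q x\<bar> \<le> K"
    using compact_imp_bounded[OF compact_continuous_image[OF q compact_cball]]
    unfolding bounded_iff by fastforce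
  have K0: "0 \<le> K" using K[of y] \<open>R > 0\<close> by auto
  have sub: "cball y (R/2) \<subseteq> ball y R" using \<open>R > 0\<close> by auto
  have cw: "continuous_on S w" using C1_on_cont C2_onD(1)[OF C2] by blast
  obtain b where b: "b \<in> cball y (R/2)" "\<And>x. x \<in> cball y (R/2) \<Longrightarrow> w x \<le> w b"
    using continuous_attains_sup[OF compact_cball, of y "R/2" w] \<open>R > 0\<close> sub S
      continuous_on_subset[OF cw, of "cball y (R/2)"] by force
  have "w b < 0" using b sub neg by blast
  have "K * w x \<le> laplacian w x" if "x \<in> ball y R" for x
  proof -
    have "(K + q x) * w x \<le> 0"
      using K[of x] neg[OF that] that by (intro mult_nonneg_nonpos) (auto simp: abs_le_iff)
    then show ?thesis using lap[OF that] by (simp add: algebra_simps)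
  qed
  from hopf[OF C2 S \<open>R > 0\<close> K0 _ w0 this _ x0, of "- w b"]
  have "grad w x0 \<bullet> (y - x0) \<le> w b * (2 * ((2 * CARD('n) + K + 1) / R\<^sup>2 + 1) * R\<^sup>2 * exp (- ((2 * CARD('n) + K + 1) / R\<^sup>2 + 1) * R\<^sup>2))"
    using b \<open>w b < 0\<close> by simp
  also have "\<dots> < 0"
  proof -
    have "(2 * CARD('n) + K + 1) / R\<^sup>2 + 1 > 0"
      using K0 \<open>R > 0\<close> by (intro add_nonneg_pos divide_nonneg_pos) auto
    then show ?thesis using \<open>w b < 0\<close> \<open>R > 0\<close> by (intro mult_neg_pos mult_pos_pos) auto
  qed
  finally show ?thesis .
qed

text \<open>Touching ball argument: grow a ball around a nearby point c with w c < 0 until it meets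
  a zero p. Hopf gives a nonzero gradient at p, but p is an interior maximum of w. The conclusion is
  openness of the zero set, ready to be combined with the connectedness of a segment.\<close>

lemma strong_maximum_principle:
  fixes w :: "real^'n::finite \<Rightarrow> real"
  assumes D: "open D" and C2: "C2_on D w" and w0: "\<And>x. x \<in> D \<Longrightarrow> w x \<le> 0"
    and q: "continuous_on D q" and lap: "\<And>x. x \<in> D \<Longrightarrow> - laplacian w x \<le> q x * w x"
  shows "open {x \<in> D. w x = 0}"
proof (subst open_subopen, intro ballI)
  fix x0 assume "x0 \<in> {x \<in> D. w x = 0}"
  then have x0: "x0 \<in> D" "w x0 = 0" by auto
  obtain e where "e > 0" "cball x0 e \<subseteq> D" using D x0 open_contains_cball by blast
  define r where "r = e / 2"
  have r: "r > 0" "cball x0 (2 * r) \<subseteq> D" using \<open>e > 0\<close> \<open>cball x0 e \<subseteq> D\<close> by (auto simp: r_def)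
  have cw: "continuous_on D w" using C1_on_cont C2_onD(1)[OF C2] by blast
  have "c \<in> {x \<in> D. w x = 0}" if c: "c \<in> ball x0 r" for c
  proof (rule ccontr)
    assume nz: "c \<notin> {x \<in> D. w x = 0}"
    have cD: "c \<in> D" using c r by auto
    \<comment> \<open>The radius 2 r leaves room: c is within r of the zero x0, so the nearest zero
      is closer than r to c and the touching ball stays in D.\<close>
    define Z where "Z = {x \<in> cball x0 (2 * r). w x = 0}"
    have "closed Z" unfolding Z_def
      by (intro continuous_closed_preimage_constant continuous_on_subset[OF cw r(2)]) auto
    moreover have "x0 \<in> Z" using x0 r by (auto simp: Z_def)
    ultimately obtain p where p: "p \<in> Z" "\<And>x. x \<in> Z \<Longrightarrow> dist c p \<le> dist c x"
      using distance_attains_inf[of Z c] by auto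
    define R where "R = dist c p"
    have "R \<le> dist c x0" using p(2) \<open>x0 \<in> Z\<close> by (simp add: R_def)
    then have Rr: "R < r" using c by (simp add: dist_commute)
    have "R > 0" using p nz cD by (auto simp: R_def Z_def)
    have sub: "cball c R \<subseteq> cball x0 (2 * r)"
    proof
      fix x assume "x \<in> cball c R"
      then show "x \<in> cball x0 (2 * r)"
        using c Rr dist_triangle[of x0 x c] by auto
    qed
    then have subD: "cball c R \<subseteq> D" using r by auto
    have pD: "p \<in> D" "w p = 0" using p r by (auto simp: Z_def)
    have "grad w p \<bullet> (c - p) < 0"
    proof (rule hopf_strict[OF C2 D subD \<open>R > 0\<close> continuous_on_subset[OF q subD]])
      show "w x < 0" if "x \<in> ball c R" for x
      proof -
        have "x \<in> cball c R" using that by auto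
        moreover have "x \<notin> Z" using p(2)[of x] that by (auto simp: R_def)
        ultimately show ?thesis using sub subD w0[of x] unfolding Z_def by fastforce
      qed
      show "- laplacian w x \<le> q x * w x" if "x \<in> ball c R" for x
        using that subD by (intro lap) auto
    qed (use subD w0 pD in \<open>auto simp: R_def\<close>)
    moreover have "(\<lambda>h. grad w p \<bullet> h) = (\<lambda>h. 0)"
      using differential_zero_maxmin[OF pD(1) D C1_on_deriv[OF C2_onD(1)[OF C2] pD(1)]] w0 pD by auto
    then have "grad w p \<bullet> (c - p) = 0" by metis
    ultimately show False by simp
  qed
  then show "\<exists>T. open T \<and> x0 \<in> T \<and> T \<subseteq> {x \<in> D. w x = 0}"
    using r by (intro exI[of _ "ball x0 r"]) auto
qed

section \<open>Integration by parts\<close>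

lemma C1_on_mult:
  fixes g h :: "real^'n::finite \<Rightarrow> real"
  assumes "C1_on S g" "C1_on S h"
  shows "C1_on S (\<lambda>x. g x * h x)"
    "x \<in> S \<Longrightarrow> partial i (\<lambda>x. g x * h x) x = partial i g x * h x + g x * partial i h x"
proof -
  have *: "((\<lambda>x. g x * h x) has_derivative (\<lambda>k. (h x *\<^sub>R grad g x + g x *\<^sub>R grad h x) \<bullet> k)) (at x)"
    if "x \<in> S" for x
    using C1_on_deriv[OF assms(1) that] C1_on_deriv[OF assms(2) that]
    by (auto intro!: derivative_eq_intros simp: inner_simps)
  show "C1_on S (\<lambda>x. g x * h x)"
    using assms[THEN C1_on_partial] assms[THEN C1_on_cont]
    by (intro C1_onI[OF *]) (auto simp: grad_def intro!: continuous_intros)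
  show "x \<in> S \<Longrightarrow> partial i (\<lambda>x. g x * h x) x = partial i g x * h x + g x * partial i h x"
    using has_derivative_grad(2)[OF *] by (simp add: grad_def)
qed

lemma C1_on_compose:
  fixes g :: "real^'n::finite \<Rightarrow> real"
  assumes g: "C1_on S g" and h: "\<And>t. (h has_real_derivative h' t) (at t)" "continuous_on UNIV h'"
  shows "C1_on S (\<lambda>x. h (g x))"
    "x \<in> S \<Longrightarrow> partial i (\<lambda>x. h (g x)) x = h' (g x) * partial i g x"
proof -
  have *: "((\<lambda>x. h (g x)) has_derivative (\<lambda>k. (h' (g x) *\<^sub>R grad g x) \<bullet> k)) (at x)"
    if "x \<in> S" for x
    using has_derivative_compose[OF C1_on_deriv[OF g that] h(1)[of "g x", unfolded has_field_derivative_def]]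
    by (simp add: inner_simps)
  show "C1_on S (\<lambda>x. h (g x))"
    using C1_on_partial[OF g] C1_on_cont[OF g]
    by (intro C1_onI[OF *])
      (auto simp: grad_def intro!: continuous_intros continuous_on_compose2[OF h(2)])
  show "x \<in> S \<Longrightarrow> partial i (\<lambda>x. h (g x)) x = h' (g x) * partial i g x"
    using has_derivative_grad(2)[OF *] by (simp add: grad_def)
qed

text \<open>The open sets D and \<open>- K\<close> cover the space; g is C^1 on the first and
  identically zero on the second.\<close>

lemma C1_on_zero_extend:
  fixes g :: "real^'n::finite \<Rightarrow> real"
  assumes "open D" "C1_on D g" "closed K" "K \<subseteq> D" and 0: "\<And>x. x \<notin> K \<Longrightarrow> g x = 0"
  shows "C1_on UNIV g" "x \<notin> K \<Longrightarrow> partial i g x = 0"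
proof -
  have *: "(g has_derivative (\<lambda>h. 0 \<bullet> h)) (at x)" if "x \<notin> K" for x
    using has_derivative_cong_open[of "- K" x g "\<lambda>_. 0" "\<lambda>_. 0"] that \<open>closed K\<close> 0 by auto
  have p0: "partial i g x = 0" if "x \<notin> K" for x i
    using has_derivative_grad(2)[OF *[OF that]] by simp
  then show "x \<notin> K \<Longrightarrow> partial i g x = 0" .
  have "continuous_on (- K) (partial i g)" for i
    by (rule continuous_on_eq[OF continuous_on_const[of _ 0]]) (simp add: p0)
  then have "continuous_on (D \<union> - K) (partial i g)" for i
    using \<open>open D\<close> \<open>closed K\<close> C1_on_partial[OF assms(2)]
    by (intro continuous_on_open_Un) auto
  moreover have "D \<union> - K = UNIV" using \<open>K \<subseteq> D\<close> by auto
  ultimately have c: "continuous_on UNIV (partial i g)" for i by metis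
  show "C1_on UNIV g"
  proof (rule C1_onI)
    show "(g has_derivative (\<lambda>h. grad g x \<bullet> h)) (at x)" for x
      using C1_on_deriv[OF assms(2), of x] *[of x] \<open>K \<subseteq> D\<close>
      by (intro differentiable_grad, cases "x \<in> K") (auto simp: differentiable_def)
  qed (use c in \<open>simp add: grad_def\<close>)
qed

text \<open>\<open>stable\<close> uses the gauge integral over \<Omega>; this passes to the Lebesgue
  integral over the whole space. Continuity is asked on K only, so a potential that is known merely
  inside \<Omega> is allowed as a factor.\<close>

lemma integrable_compact_support:
  fixes g :: "'a::euclidean_space \<Rightarrow> real"
  assumes "compact K" "continuous_on K g" "\<And>x. x \<notin> K \<Longrightarrow> g x = 0"
  shows "integrable lborel g" "K \<subseteq> S \<Longrightarrow> integral S g = integral\<^sup>L lborel g"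
proof -
  have "(\<lambda>x. indicator K x *\<^sub>R g x) = g"
    using assms(3) by (auto simp: indicator_def fun_eq_iff)
  with borel_integrable_compact[OF assms(1,2)] show i: "integrable lborel g" by metis
  assume "K \<subseteq> S"
  have "(g has_integral (integral\<^sup>L lborel g)) UNIV"
    by (rule has_integral_integral_lborel[OF i])
  moreover have "(\<lambda>x. if x \<in> S then g x else 0) = g" using assms(3) \<open>K \<subseteq> S\<close> by (auto simp: fun_eq_iff)
  ultimately have "(g has_integral (integral\<^sup>L lborel g)) S"
    using has_integral_restrict_UNIV[of S g] by metis
  then show "integral S g = integral\<^sup>L lborel g" by (rule integral_unique)
qed

text \<open>By translation invariance all difference quotients of \<open>F\<close> integrate to zero.\<close>

lemma integral_partial_eq_0:
  fixes F :: "real^'n::finite \<Rightarrow> real"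
  assumes F: "C1_on UNIV F" and K: "compact K" "\<And>x. x \<notin> K \<Longrightarrow> F x = 0"
  shows "integral\<^sup>L lborel (partial i F) = 0"
proof -
  let ?e = "axis i 1 :: real^'n"
  define s where "s n x = (F (x + inverse (real (Suc n)) *\<^sub>R ?e) - F x) / inverse (real (Suc n))" for n x
  have cF: "continuous_on UNIV F" by (rule C1_on_cont[OF F])
  have pF: "continuous_on UNIV (partial i F)" by (rule C1_on_partial[OF F])
  have p0: "partial i F x = 0" if "x \<notin> K" for x
    using C1_on_zero_extend(2)[OF open_UNIV F compact_imp_closed[OF K(1)] subset_UNIV K(2) that] .
  have "bounded (partial i F ` K)"
    by (intro compact_imp_bounded compact_continuous_image continuous_on_subset[OF pF] K) auto
  then obtain M' where M': "\<And>x. x \<in> K \<Longrightarrow> \<bar>partial i F x\<bar> \<le> M'"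
    unfolding bounded_iff by fastforce
  define M where "M = max M' 0"
  have M: "\<bar>partial i F x\<bar> \<le> M" for x
    using M'[of x] p0[of x] by (cases "x \<in> K") (auto simp: M_def)
  \<comment> \<open>All points from which a step of length at most 1 along the axis can reach K; it
    contains the support of every difference quotient, so M times its indicator dominates.\<close>
  define K' where "K' = (\<lambda>p. fst p - snd p *\<^sub>R ?e) ` (K \<times> {0..1})"
  have cK': "compact K'" unfolding K'_def
    by (intro compact_continuous_image compact_Times K compact_Icc continuous_intros)
  have F0: "F (x + t *\<^sub>R ?e) = 0" if "x \<notin> K'" "0 \<le> t" "t \<le> 1" for x t
  proof (rule K(2))
    show "x + t *\<^sub>R ?e \<notin> K"
    proof
      assume "x + t *\<^sub>R ?e \<in> K"
      then have "x \<in> K'" using that(2,3)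
        unfolding K'_def by (intro image_eqI[of _ _ "(x + t *\<^sub>R ?e, t)"]) auto
      with that show False by simp
    qed
  qed
  have D: "((\<lambda>t. F (x + t *\<^sub>R ?e)) has_real_derivative partial i F (x + t *\<^sub>R ?e)) (at t)" for x t
    by (rule partial_line[OF F]) simp
  have b: "norm (s n x) \<le> M * indicator K' x" for n x
  proof (cases "x \<in> K'")
    case True
    let ?h = "inverse (real (Suc n))"
    have h: "0 < ?h" by simp
    obtain y where "F (x + ?h *\<^sub>R ?e) - F (x + 0 *\<^sub>R ?e) = (?h - 0) * partial i F (x + y *\<^sub>R ?e)"
      using MVT2[OF h, of "\<lambda>t. F (x + t *\<^sub>R ?e)" "\<lambda>t. partial i F (x + t *\<^sub>R ?e)"] D by blast
    then have "s n x = partial i F (x + y *\<^sub>R ?e)" using h by (simp add: s_def field_simps)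
    then show ?thesis using True M by simp
  next
    case False
    have "inverse (real (Suc n)) \<le> 1" by (simp add: inverse_le_1_iff)
    then have "s n x = 0" using F0[OF False, of "inverse (real (Suc n))"] F0[OF False, of 0]
      by (simp add: s_def)
    then show ?thesis using False by simp
  qed
  have lim: "(\<lambda>n. s n x) \<longlonglongrightarrow> partial i F x" for x
  proof -
    have "(\<lambda>h. (F (x + h *\<^sub>R ?e) - F x) / h) \<midarrow>0\<rightarrow> partial i F x"
      using D[of x 0] by (simp add: DERIV_def)
    moreover have "filterlim (\<lambda>n. inverse (real (Suc n))) (at 0) sequentially"
      by (intro filterlim_atI LIMSEQ_inverse_real_of_nat) auto
    ultimately show ?thesis unfolding s_def by (rule filterlim_compose)
  qed
  have iF: "integrable lborel F"
    by (rule integrable_compact_support[OF K(1) _ K(2)]) (auto intro: continuous_on_subset[OF cF])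
  have mF: "F \<in> borel_measurable borel" by (rule borel_measurable_continuous_onI[OF cF])
  have "integral\<^sup>L lborel (\<lambda>x. F (x + c)) = integral\<^sup>L lborel F" for c
    using integral_distr[of "(+) c" lborel borel F] mF by (simp add: lborel_distr_plus add.commute[of c])
  moreover have "integrable lborel (\<lambda>x. F (x + c))" for c
    using integrable_distr[of "(+) c" lborel borel F] iF by (simp add: lborel_distr_plus add.commute[of c])
  ultimately have "integral\<^sup>L lborel (s n) = 0" for n
    unfolding s_def using iF by simp
  moreover have "(\<lambda>n. integral\<^sup>L lborel (s n)) \<longlonglongrightarrow> integral\<^sup>L lborel (partial i F)"
  proof (rule integral_dominated_convergence)
    show "partial i F \<in> borel_measurable lborel"
      using borel_measurable_continuous_onI[OF pF] by simp
    show "s n \<in> borel_measurable lborel" for n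
    proof -
      have "continuous_on UNIV (s n)" unfolding s_def
        by (intro continuous_intros continuous_on_compose2[OF cF]) auto
      then show ?thesis using borel_measurable_continuous_onI by simp
    qed
    show "integrable lborel (\<lambda>x. M * indicator K' x :: real)"
      using borel_integrable_compact[OF cK', of "\<lambda>_. M"] by (simp add: mult.commute)
  qed (use lim b in auto)
  ultimately show ?thesis by (simp add: LIMSEQ_const_iff)
qed

text \<open>Each field component \<open>a x * partial i v x\<close> is C^1 with support in K, so the
  integral of its i-th derivative vanishes. Since a vanishes off K, the behaviour of v outside D
  does not enter.\<close>

lemma green_identity:
  fixes a v :: "real^'n::finite \<Rightarrow> real"
  assumes D: "open D" and K: "compact K" "K \<subseteq> D"
    and a: "C1_on D a" and a0: "\<And>x. x \<notin> K \<Longrightarrow> a x = 0" and v: "C2_on D v"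
  shows "integral\<^sup>L lborel (\<lambda>x. grad a x \<bullet> grad v x) = integral\<^sup>L lborel (\<lambda>x. - (a x * laplacian v x))"
proof -
  note cK = compact_imp_closed[OF K(1)]
  have pa0: "partial i a x = 0" if "x \<notin> K" for x i
    by (rule C1_on_zero_extend(2)[OF D a cK K(2) a0 that])
  have F0: "a x * partial i v x = 0" if "x \<notin> K" for x i using a0[OF that] by simp
  note M = C1_on_mult[OF a C2_onD(2)[OF v]]
  note E = C1_on_zero_extend[OF D M(1) cK K(2) F0]
  have p: "partial i (\<lambda>x. a x * partial i v x) x = partial i a x * partial i v x + a x * partial i (partial i v) x"
    for i x
    using M(2)[of x i i] E(2)[of x i i] pa0[of x i] a0[of x] K(2) by (cases "x \<in> K") auto
  have z: "integral\<^sup>L lborel (\<lambda>x. partial i a x * partial i v x + a x * partial i (partial i v) x) = 0" for i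
    using integral_partial_eq_0[OF E(1) K(1) F0, of i i] by (simp add: p[abs_def])
  have c: "continuous_on K a" "\<And>i. continuous_on K (partial i a)" "\<And>i. continuous_on K (partial i v)"
      "\<And>i j. continuous_on K (partial j (partial i v))"
    using C1_on_cont[OF a] C1_on_partial[OF a] C1_on_partial[OF C2_onD(1)[OF v]] C1_on_partial[OF C2_onD(2)[OF v]]
      continuous_on_subset[OF _ K(2)] by blast+
  have i1: "integrable lborel (\<lambda>x. partial i a x * partial i v x)" for i
    by (rule integrable_compact_support[OF K(1)]) (auto intro!: continuous_intros c simp: pa0)
  have i2: "integrable lborel (\<lambda>x. a x * partial i (partial i v) x)" for i
    by (rule integrable_compact_support[OF K(1)]) (auto intro!: continuous_intros c simp: a0)
  have "integral\<^sup>L lborel (\<lambda>x. grad a x \<bullet> grad v x) = (\<Sum>i\<in>UNIV. integral\<^sup>L lborel (\<lambda>x. partial i a x * partial i v x))"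
    using i1 by (simp add: inner_vec_def grad_def)
  also have "\<dots> = (\<Sum>i\<in>UNIV. - integral\<^sup>L lborel (\<lambda>x. a x * partial i (partial i v) x))"
    using z i1 i2 by (intro sum.cong) (auto simp: eq_neg_iff_add_eq_0)
  also have "\<dots> = integral\<^sup>L lborel (\<lambda>x. - (a x * laplacian v x))"
    using i2 by (simp add: laplacian_def sum_distrib_left sum_negf)
  finally show ?thesis .
qed

section \<open>Smoothing the positive part of a function\<close>

lemma positive_part_deriv:
  fixes g :: "real \<Rightarrow> real"
  assumes g: "\<And>t. (g has_real_derivative g' t) (at t)" and "g 0 = 0" "g' 0 = 0"
    and c: "continuous_on UNIV g'"
  shows "((\<lambda>t. if t \<le> 0 then 0 else g t) has_real_derivative (if t \<le> 0 then 0 else g' t)) (at t)"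
    "continuous_on UNIV (\<lambda>t. if t \<le> 0 then 0 else g' t)"
proof -
  let ?p = "\<lambda>t. if t \<le> 0 then 0 else g t"
  consider "t < 0" | "t = 0" | "t > 0" by linarith
  then show "(?p has_real_derivative (if t \<le> 0 then 0 else g' t)) (at t)"
  proof cases
    case 1
    have "((\<lambda>_. 0) has_real_derivative 0) (at t)" by simp
    from has_field_derivative_transform_within_open[OF this, of "{..<0}" ?p] 1 show ?thesis by simp
  next
    case 2
    have "((\<lambda>y. (g y - g 0) / (y - 0)) \<longlongrightarrow> 0) (at 0)"
      using g[of 0] \<open>g' 0 = 0\<close> by (simp add: has_field_derivative_iff)
    then have "((\<lambda>y. norm (g y / y)) \<longlongrightarrow> 0) (at 0)"
      using \<open>g 0 = 0\<close> tendsto_norm_zero by fastforce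
    then have "((\<lambda>y. ?p y / y) \<longlongrightarrow> 0) (at 0)"
      by (rule Lim_null_comparison[rotated]) (auto intro!: always_eventually divide_nonneg_nonpos)
    then show ?thesis using 2 by (simp add: has_field_derivative_iff)
  next
    case 3
    from has_field_derivative_transform_within_open[OF g[of t], of "{0<..}" ?p] 3 show ?thesis by simp
  qed
  have "continuous_on ({..0} \<union> {0..}) (\<lambda>t. if t \<le> 0 then 0 else g' t)"
    by (rule continuous_on_cases) (auto intro!: continuous_on_subset[OF c] simp: \<open>g' 0 = 0\<close>)
  moreover have "{..0} \<union> {0..} = (UNIV :: real set)" by auto
  ultimately show "continuous_on UNIV (\<lambda>t. if t \<le> 0 then 0 else g' t)" by metis
qed

section \<open>Maximum principle from stability\<close>

text \<open>\<open>smooth_pos_prim \<delta>\<close> is the primitive of \<open>(smooth_pos' \<delta>)\<^sup>2\<close>, chosen so that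
  \<open>grad_sq (smooth_pos \<delta> \<circ> z) = grad (smooth_pos_prim \<delta> \<circ> z) \<bullet> grad z\<close>.\<close>

definition smooth_pos :: "real \<Rightarrow> real \<Rightarrow> real" where
  "smooth_pos \<delta> t = (if t \<le> 0 then 0 else sqrt (t\<^sup>2 + \<delta>\<^sup>2) - \<delta>)"

definition smooth_pos' :: "real \<Rightarrow> real \<Rightarrow> real" where
  "smooth_pos' \<delta> t = (if t \<le> 0 then 0 else t / sqrt (t\<^sup>2 + \<delta>\<^sup>2))"

definition smooth_pos_prim :: "real \<Rightarrow> real \<Rightarrow> real" where
  "smooth_pos_prim \<delta> t = (if t \<le> 0 then 0 else t - \<delta> * arctan (t / \<delta>))"

lemma smooth_pos_deriv:
  assumes "\<delta> > 0"
  shows "(smooth_pos \<delta> has_real_derivative smooth_pos' \<delta> t) (at t)" "continuous_on UNIV (smooth_pos' \<delta>)"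
proof -
  have p: "t\<^sup>2 + \<delta>\<^sup>2 > 0" for t using assms by (simp add: add_nonneg_pos)
  then have nz: "t\<^sup>2 + \<delta>\<^sup>2 \<noteq> 0" for t by (metis less_irrefl)
  have "((\<lambda>t. sqrt (t\<^sup>2 + \<delta>\<^sup>2) - \<delta>) has_real_derivative t / sqrt (t\<^sup>2 + \<delta>\<^sup>2)) (at t)" for t
    using p[of t] by (auto intro!: derivative_eq_intros simp: field_simps)
  moreover have "continuous_on UNIV (\<lambda>t. t / sqrt (t\<^sup>2 + \<delta>\<^sup>2))"
    using nz by (intro continuous_intros) auto
  moreover have "sqrt (0\<^sup>2 + \<delta>\<^sup>2) - \<delta> = 0" using assms by simp
  ultimately show "(smooth_pos \<delta> has_real_derivative smooth_pos' \<delta> t) (at t)" "continuous_on UNIV (smooth_pos' \<delta>)"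
    unfolding smooth_pos_def[abs_def] smooth_pos'_def[abs_def]
    using positive_part_deriv[of "\<lambda>t. sqrt (t\<^sup>2 + \<delta>\<^sup>2) - \<delta>" "\<lambda>t. t / sqrt (t\<^sup>2 + \<delta>\<^sup>2)"] by simp_all
qed

lemma smooth_pos_prim_deriv:
  assumes "\<delta> > 0"
  shows "(smooth_pos_prim \<delta> has_real_derivative (smooth_pos' \<delta> t)\<^sup>2) (at t)" "continuous_on UNIV (\<lambda>t. (smooth_pos' \<delta> t)\<^sup>2)"
proof -
  have p: "t\<^sup>2 + \<delta>\<^sup>2 > 0" for t using assms by (simp add: add_nonneg_pos)
  have "((\<lambda>t. t - \<delta> * arctan (t / \<delta>)) has_real_derivative t\<^sup>2 / (t\<^sup>2 + \<delta>\<^sup>2)) (at t)" for t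
    using p[of t] assms
    by (auto intro!: derivative_eq_intros simp: divide_simps power2_eq_square)
  moreover have sq: "(smooth_pos' \<delta> t)\<^sup>2 = (if t \<le> 0 then 0 else t\<^sup>2 / (t\<^sup>2 + \<delta>\<^sup>2))" for t
    using p[of t] by (simp add: smooth_pos'_def power_divide)
  moreover show c: "continuous_on UNIV (\<lambda>t. (smooth_pos' \<delta> t)\<^sup>2)"
    by (intro continuous_intros smooth_pos_deriv assms)
  moreover have "continuous_on UNIV (\<lambda>t. t\<^sup>2 / (t\<^sup>2 + \<delta>\<^sup>2))"
    using p by (intro continuous_intros) (metis less_irrefl)
  ultimately show "(smooth_pos_prim \<delta> has_real_derivative (smooth_pos' \<delta> t)\<^sup>2) (at t)"
    unfolding smooth_pos_prim_def[abs_def] sq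
    using positive_part_deriv(1)[of "\<lambda>t. t - \<delta> * arctan (t / \<delta>)" "\<lambda>t. t\<^sup>2 / (t\<^sup>2 + \<delta>\<^sup>2)"] by simp
qed

text \<open>The last bound measures the mismatch, after multiplication by q, between testing the
  inequality for z with \<open>smooth_pos_prim\<close> and the square in the stability form. Its two
  error terms, 2 \<delta> (r - \<delta>) and t a, both lie between 0 and 2 \<delta> t; for the
  second, arctan < pi/2 < 2.\<close>

lemma smooth_pos_bounds:
  assumes "\<delta> > 0"
  shows "smooth_pos \<delta> t \<ge> t - \<delta>" "smooth_pos \<delta> t \<ge> 0" "0 \<le> smooth_pos_prim \<delta> t" "t \<ge> 0 \<Longrightarrow> smooth_pos_prim \<delta> t \<le> t"
    "t \<ge> 0 \<Longrightarrow> \<bar>t * smooth_pos_prim \<delta> t - (smooth_pos \<delta> t)\<^sup>2\<bar> \<le> 2 * \<delta> * t"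
proof -
  have "0 \<le> smooth_pos \<delta> t \<and> t - \<delta> \<le> smooth_pos \<delta> t \<and> 0 \<le> smooth_pos_prim \<delta> t \<and> (t \<ge> 0 \<longrightarrow> smooth_pos_prim \<delta> t \<le> t)
    \<and> (t \<ge> 0 \<longrightarrow> \<bar>t * smooth_pos_prim \<delta> t - (smooth_pos \<delta> t)\<^sup>2\<bar> \<le> 2 * \<delta> * t)"
  proof (cases "t \<le> 0")
    case True
    then show ?thesis using assms by (auto simp: smooth_pos_def smooth_pos_prim_def)
  next
    case False
    then have t: "t > 0" by simp
    define r where "r = sqrt (t\<^sup>2 + \<delta>\<^sup>2)"
    have r2: "r\<^sup>2 = t\<^sup>2 + \<delta>\<^sup>2" by (simp add: r_def)
    have r1: "t \<le> r" "\<delta> \<le> r" by (auto simp: r_def intro: real_le_rsqrt)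
    have r3: "r \<le> t + \<delta>" unfolding r_def
      using t assms by (intro real_le_lsqrt) (auto simp: power2_eq_square algebra_simps)
    define a where "a = \<delta> * arctan (t / \<delta>)"
    have a0: "0 \<le> a" using t assms by (simp add: a_def)
    have "arctan (t / \<delta>) \<le> t / \<delta>" using t assms by (intro arctan_le_self) auto
    then have a1: "a \<le> t" using assms by (simp add: a_def field_simps)
    have hh: "smooth_pos \<delta> t = r - \<delta>" "smooth_pos_prim \<delta> t = t - a" using t by (auto simp: smooth_pos_def smooth_pos_prim_def r_def a_def)
    have "a \<le> \<delta> * 2"
      using arctan_ubound[of "t / \<delta>"] pi_less_4 assms unfolding a_def
      by (intro mult_left_mono) auto
    then have a2: "t * a \<le> 2 * \<delta> * t" using t mult_right_mono[of a "\<delta> * 2" t] by (simp add: algebra_simps)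
    have e: "t * (t - a) - (r - \<delta>)\<^sup>2 = 2 * \<delta> * (r - \<delta>) - t * a"
      using r2 by (simp add: power2_eq_square algebra_simps)
    have "2 * \<delta> * (r - \<delta>) \<le> 2 * \<delta> * t" "0 \<le> 2 * \<delta> * (r - \<delta>)" "0 \<le> t * a"
      using r1 r3 assms a0 t by (auto intro!: mult_left_mono)
    then have "\<bar>t * (t - a) - (r - \<delta>)\<^sup>2\<bar> \<le> 2 * \<delta> * t" unfolding e using a2 by linarith
    then show ?thesis unfolding hh using r1 r3 a0 a1 t by auto
  qed
  then show "smooth_pos \<delta> t \<ge> t - \<delta>" "smooth_pos \<delta> t \<ge> 0" "0 \<le> smooth_pos_prim \<delta> t" "t \<ge> 0 \<Longrightarrow> smooth_pos_prim \<delta> t \<le> t"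
    "t \<ge> 0 \<Longrightarrow> \<bar>t * smooth_pos_prim \<delta> t - (smooth_pos \<delta> t)\<^sup>2\<bar> \<le> 2 * \<delta> * t" by auto
qed

lemma smooth_pos_0: "t \<le> 0 \<Longrightarrow> smooth_pos \<delta> t = 0" "t \<le> 0 \<Longrightarrow> smooth_pos_prim \<delta> t = 0"
  by (auto simp: smooth_pos_def smooth_pos_prim_def)

text \<open>The supersolution \<open>\<psi>\<close> replaces the constant \<open>1\<close>: the potential \<open>q\<close> may be unbounded near the boundary,
  but \<open>w - \<epsilon> \<psi>\<close> has positive part compactly supported in \<open>D\<close>.\<close>

lemma stable_maximum_principle:
  fixes w \<psi> q :: "real^'n::finite \<Rightarrow> real" and \<Omega> D :: "(real^'n) set"
  assumes stab: "\<And>\<phi>. C1_on UNIV \<phi> \<Longrightarrow> compact (closure {x. \<phi> x \<noteq> 0}) \<Longrightarrow> closure {x. \<phi> x \<noteq> 0} \<subseteq> \<Omega> \<Longrightarrow>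
      integral \<Omega> (\<lambda>x. grad_sq \<phi> x - q x * (\<phi> x)\<^sup>2) \<ge> c * integral \<Omega> (\<lambda>x. (\<phi> x)\<^sup>2)"
    and "c > 0" and "bounded \<Omega>" and q: "continuous_on \<Omega> q"
    and D: "open D" "D \<subseteq> \<Omega>" and w: "C2_on D w" and cw: "continuous_on (closure D) w"
    and wb: "\<And>x. x \<in> frontier D \<Longrightarrow> w x \<le> 0"
    and wl: "\<And>x. x \<in> D \<Longrightarrow> w x > 0 \<Longrightarrow> - laplacian w x \<le> q x * w x"
    and psi: "C2_on D \<psi>" and psi1: "\<And>x. x \<in> D \<Longrightarrow> \<psi> x \<ge> 1"
    and psil: "\<And>x. x \<in> D \<Longrightarrow> - laplacian \<psi> x - q x * \<psi> x \<ge> - C" and "C \<ge> 0"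
    and "x0 \<in> D"
  shows "w x0 \<le> 0"
proof (rule ccontr)
  assume neg: "\<not> w x0 \<le> 0"
  have "bounded D" using \<open>bounded \<Omega>\<close> D(2) bounded_subset by blast
  then have cD: "compact (closure D)" by (simp add: compact_closure)
  \<comment> \<open>A third each time: w \<ge> 2 \<eta> on a small ball, \<epsilon> \<psi> takes
    away at most \<eta>, and the smoothing at most \<eta>/2, leaving \<phi> \<ge> \<eta>/2
    there.\<close>
  define \<eta> where "\<eta> = w x0 / 3"
  have "\<eta> > 0" using neg by (simp add: \<eta>_def)
  have cwD: "continuous_on D w" using cw closure_subset continuous_on_subset by blast
  have cpD: "continuous_on D \<psi>" by (rule C1_on_cont[OF C2_onD(1)[OF psi]])
  obtain r where r: "r > 0" "ball x0 r \<subseteq> D" "\<And>x. x \<in> ball x0 r \<Longrightarrow> w x \<ge> 2 * \<eta> \<and> \<psi> x \<le> \<psi> x0 + 1"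
  proof -
    have "isCont w x0" "isCont \<psi> x0"
      using cwD cpD D(1) \<open>x0 \<in> D\<close> continuous_on_eq_continuous_at by blast+
    moreover have "2 * \<eta> < w x0" using neg by (simp add: \<eta>_def)
    ultimately have "\<forall>\<^sub>F x in nhds x0. w x > 2 * \<eta>" "\<forall>\<^sub>F x in nhds x0. \<psi> x < \<psi> x0 + 1"
      unfolding isCont_def tendsto_at_iff_tendsto_nhds by (auto intro!: order_tendstoD)
    moreover have "\<forall>\<^sub>F x in nhds x0. x \<in> D"
      using D(1) \<open>x0 \<in> D\<close> by (rule eventually_nhds_in_open)
    ultimately have "\<forall>\<^sub>F x in nhds x0. w x > 2 * \<eta> \<and> \<psi> x < \<psi> x0 + 1 \<and> x \<in> D"
      by eventually_elim simp
    then obtain r where "r > 0" "\<And>x. dist x x0 < r \<Longrightarrow> w x > 2 * \<eta> \<and> \<psi> x < \<psi> x0 + 1 \<and> x \<in> D"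
      unfolding eventually_nhds_metric by blast
    then show ?thesis by (intro that[of r]) (force simp: dist_commute)+
  qed
  have "bounded (w ` closure D)"
    by (intro compact_imp_bounded compact_continuous_image cw cD)
  then obtain W where W: "\<And>x. x \<in> closure D \<Longrightarrow> \<bar>w x\<bar> \<le> W"
    unfolding bounded_iff by fastforce
  have "W \<ge> 0" using W[of x0] \<open>x0 \<in> D\<close> closure_subset by fastforce
  define V where "V = measure lborel (closure D)"
  have "V \<ge> 0" by (simp add: V_def)
  \<comment> \<open>The lower bound for c times the integral of \<phi>^2, fixed independently of
    \<epsilon> and \<delta>; each of the two errors will be kept below \<beta>/4.\<close>
  define \<beta> where "\<beta> = c * ((\<eta> / 2)\<^sup>2 * measure lborel (ball x0 r))"
  have "\<beta> > 0" using \<open>c > 0\<close> \<open>\<eta> > 0\<close> content_ball_pos[OF r(1), of x0] by (simp add: \<beta>_def)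
  define P where "P = \<psi> x0 + 1"
  have "P \<ge> 1" using psi1[OF \<open>x0 \<in> D\<close>] by (simp add: P_def)
  \<comment> \<open>The first entry protects \<phi> on the small ball, the second bounds the error
    \<epsilon> C W V that comes from \<psi> being a supersolution only up to C. The added 1 avoids a
    zero denominator.\<close>
  define \<epsilon> where "\<epsilon> = min (\<eta> / P) (\<beta> / (4 * (C * W * V + 1)))"
  have CWV: "C * W * V \<ge> 0" using \<open>C \<ge> 0\<close> \<open>W \<ge> 0\<close> \<open>V \<ge> 0\<close> by simp
  have "\<epsilon> > 0" using \<open>\<eta> > 0\<close> \<open>P \<ge> 1\<close> \<open>\<beta> > 0\<close> CWV by (auto simp: \<epsilon>_def intro!: divide_pos_pos)
  have eP: "\<epsilon> * P \<le> \<eta>"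
  proof -
    have "\<epsilon> \<le> \<eta> / P" by (simp add: \<epsilon>_def)
    then show ?thesis using \<open>P \<ge> 1\<close> by (simp add: field_simps)
  qed
  have eC: "\<epsilon> * (C * W * V) \<le> \<beta> / 4"
  proof -
    have "\<epsilon> * (C * W * V) \<le> \<epsilon> * (C * W * V + 1)" using \<open>\<epsilon> > 0\<close> by simp
    also have "\<dots> \<le> \<beta> / (4 * (C * W * V + 1)) * (C * W * V + 1)"
      using CWV by (intro mult_right_mono) (auto simp: \<epsilon>_def)
    also have "\<dots> = \<beta> / 4" using CWV by (simp add: field_simps)
    finally show ?thesis .
  qed
  define z where "z x = w x - \<epsilon> * \<psi> x" for x
  have zeq: "z = (\<lambda>x. 1 * w x + (- \<epsilon>) * \<psi> x + 0)" by (auto simp: z_def)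
  have zC2: "C2_on D z" and zlap: "\<And>x. x \<in> D \<Longrightarrow> laplacian z x = laplacian w x - \<epsilon> * laplacian \<psi> x"
    unfolding zeq using C2_on_lincomb[OF D(1) w psi, where a = 1 and b = "- \<epsilon>" and c = 0] by simp_all
  note zC1 = C2_onD(1)[OF zC2]
  \<comment> \<open>Compact inside D, because w \<le> 0 < \<epsilon> on the frontier. It contains
    every point of D with z > 0, because \<psi> \<ge> 1 turns z > 0 into w > \<epsilon>.\<close>
  define K where "K = {x \<in> closure D. w x \<ge> \<epsilon>}"
  have "K \<subseteq> D"
    using wb \<open>\<epsilon> > 0\<close> D(1) by (auto simp: K_def frontier_def interior_open) fastforce
  have "closed K"
    unfolding K_def using continuous_closed_preimage[OF cw closed_closure closed_atLeast[of \<epsilon>]]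
    by (simp add: vimage_def Int_def)
  moreover have "K \<subseteq> closure D" by (auto simp: K_def)
  ultimately have "compact K" using cD compact_Int_closed[of "closure D" K] by (simp add: Int_absorb1)
  have zK: "x \<in> K" if "x \<in> D" "z x > 0" for x
  proof -
    have "\<epsilon> * 1 \<le> \<epsilon> * \<psi> x" using psi1[OF that(1)] \<open>\<epsilon> > 0\<close> by (intro mult_left_mono) auto
    then show ?thesis using that closure_subset by (force simp: z_def K_def)
  qed
  have zW: "z x \<le> W" if "x \<in> D" for x
  proof -
    have "0 \<le> \<epsilon> * \<psi> x" using psi1[OF that] \<open>\<epsilon> > 0\<close> by simp
    then show ?thesis using W[of x] that closure_subset by (force simp: z_def)
  qed
  have zlow: "z x \<ge> \<eta>" if "x \<in> ball x0 r" for x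
  proof -
    have "\<epsilon> * \<psi> x \<le> \<epsilon> * P" using r(3)[OF that] \<open>\<epsilon> > 0\<close> by (intro mult_left_mono) (auto simp: P_def)
    then show ?thesis using eP r(3)[OF that] by (simp add: z_def)
  qed
  have "continuous_on K q" using q \<open>K \<subseteq> D\<close> D(2) continuous_on_subset by blast
  then have "bounded (q ` K)"
    by (intro compact_imp_bounded compact_continuous_image \<open>compact K\<close>)
  then obtain M where M: "\<And>x. x \<in> K \<Longrightarrow> \<bar>q x\<bar> \<le> M"
    unfolding bounded_iff by fastforce
  define M' where "M' = \<bar>M\<bar>"
  have M': "\<And>x. x \<in> K \<Longrightarrow> \<bar>q x\<bar> \<le> M'" "M' \<ge> 0" using M by (fastforce simp: M'_def)+
  \<comment> \<open>Chosen after \<epsilon>, as M' bounds q on the set K, which depends on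
    \<epsilon>; 8 instead of 4 absorbs the factor 2 of the smoothing error.\<close>
  define \<delta> where "\<delta> = min (\<eta> / 2) (\<beta> / (8 * (M' * W * V + 1)))"
  have MWV: "M' * W * V \<ge> 0" using \<open>M' \<ge> 0\<close> \<open>W \<ge> 0\<close> \<open>V \<ge> 0\<close> by simp
  have "\<delta> > 0" using \<open>\<eta> > 0\<close> \<open>\<beta> > 0\<close> MWV by (auto simp: \<delta>_def intro!: divide_pos_pos)
  have dM: "2 * \<delta> * (M' * W * V) \<le> \<beta> / 4"
  proof -
    have "2 * \<delta> * (M' * W * V) \<le> 2 * \<delta> * (M' * W * V + 1)" using \<open>\<delta> > 0\<close> by simp
    also have "\<dots> \<le> 2 * (\<beta> / (8 * (M' * W * V + 1))) * (M' * W * V + 1)"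
      using MWV by (intro mult_right_mono) (auto simp: \<delta>_def)
    also have "\<dots> = \<beta> / 4" using MWV by (simp add: field_simps)
    finally show ?thesis .
  qed
  \<comment> \<open>Cutting off at K rather than where z \<le> 0 is needed since z has no meaning
    outside D. Inside D the cut changes nothing, both smoothings being zero for z \<le> 0.\<close>
  define \<phi> where "\<phi> x = (if x \<in> K then smooth_pos \<delta> (z x) else 0)" for x
  define a where "a x = (if x \<in> K then smooth_pos_prim \<delta> (z x) else 0)" for x
  have \<phi>D: "\<forall>x\<in>D. \<phi> x = smooth_pos \<delta> (z x)" and aD: "\<forall>x\<in>D. a x = smooth_pos_prim \<delta> (z x)"
    using zK smooth_pos_0 unfolding \<phi>_def a_def by (metis not_less)+
  have \<phi>0: "x \<notin> K \<Longrightarrow> \<phi> x = 0" and a0: "x \<notin> K \<Longrightarrow> a x = 0" for x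
    by (auto simp: \<phi>_def a_def)
  note ch = C1_on_compose[OF zC1 smooth_pos_deriv[OF \<open>\<delta> > 0\<close>]]
  note cH = C1_on_compose[OF zC1 smooth_pos_prim_deriv[OF \<open>\<delta> > 0\<close>]]
  note \<phi>C = C1_on_cong[OF D(1) \<phi>D ch(1)] and aC = C1_on_cong[OF D(1) aD cH(1)]
  note \<phi>E = C1_on_zero_extend[OF D(1) \<phi>C(1) \<open>closed K\<close> \<open>K \<subseteq> D\<close> \<phi>0]
  note aE = C1_on_zero_extend[OF D(1) aC(1) \<open>closed K\<close> \<open>K \<subseteq> D\<close> a0]
  have gsq: "grad_sq \<phi> x = grad a x \<bullet> grad z x" for x
  proof (cases "x \<in> K")
    case True
    then have "x \<in> D" using \<open>K \<subseteq> D\<close> by auto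
    then have "partial i \<phi> x = smooth_pos' \<delta> (z x) * partial i z x" "partial i a x = (smooth_pos' \<delta> (z x))\<^sup>2 * partial i z x" for i
      using \<phi>C(2) ch(2) aC(2) cH(2) by auto
    then show ?thesis
      by (simp add: grad_sq_def grad_def inner_vec_def power2_eq_square mult_ac)
  next
    case False
    then show ?thesis using \<phi>E(2) aE(2)
      by (simp add: grad_sq_def grad_def inner_vec_def)
  qed
  have supp: "closure {x. \<phi> x \<noteq> 0} \<subseteq> K"
    using \<phi>0 \<open>closed K\<close> by (intro closure_minimal) auto
  then have csupp: "compact (closure {x. \<phi> x \<noteq> 0})"
    using \<open>compact K\<close> by (metis closed_closure compact_Int_closed inf.absorb_iff2)
  have K\<Omega>: "K \<subseteq> \<Omega>" using \<open>K \<subseteq> D\<close> D by auto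
  have cphi: "continuous_on K \<phi>"
    and cq: "continuous_on K q" and ca: "continuous_on K a" and clap: "continuous_on K (laplacian z)"
    and cga: "\<And>i. continuous_on K (partial i a)" and cgz: "\<And>i. continuous_on K (partial i z)"
    unfolding laplacian_def[abs_def]
    by (intro continuous_on_sum continuous_on_subset[OF q K\<Omega>] continuous_on_subset[OF _ \<open>K \<subseteq> D\<close>]
        C1_on_cont[OF \<phi>C(1)] C1_on_partial[OF \<phi>C(1)] C1_on_cont[OF aC(1)] C1_on_partial[OF aC(1)]
        C1_on_partial[OF zC1] C1_on_partial[OF C2_onD(2)[OF zC2]])+
  have I2: "integrable lborel (\<lambda>x. (\<phi> x)\<^sup>2)" "integral \<Omega> (\<lambda>x. (\<phi> x)\<^sup>2) = integral\<^sup>L lborel (\<lambda>x. (\<phi> x)\<^sup>2)"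
    using K\<Omega> by (auto intro!: integrable_compact_support[OF \<open>compact K\<close>] continuous_intros cphi simp: \<phi>0)
  have Iq: "integrable lborel (\<lambda>x. q x * (\<phi> x)\<^sup>2)"
    by (rule integrable_compact_support[OF \<open>compact K\<close>]) (auto intro!: continuous_intros cphi cq simp: \<phi>0)
  have Ig: "integrable lborel (\<lambda>x. grad a x \<bullet> grad z x)"
    by (rule integrable_compact_support[OF \<open>compact K\<close>])
      (auto intro!: continuous_intros cga cgz simp: inner_vec_def grad_def aE(2))
  have Ia: "integrable lborel (\<lambda>x. - (a x * laplacian z x))"
    by (rule integrable_compact_support[OF \<open>compact K\<close>]) (auto intro!: continuous_intros ca clap simp: a0)
  have "integral \<Omega> (\<lambda>x. grad_sq \<phi> x - q x * (\<phi> x)\<^sup>2) = integral\<^sup>L lborel (\<lambda>x. grad a x \<bullet> grad z x - q x * (\<phi> x)\<^sup>2)"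
    unfolding gsq using K\<Omega>
    by (intro integrable_compact_support(2)[OF \<open>compact K\<close>])
      (auto intro!: continuous_intros cga cgz cphi cq simp: inner_vec_def grad_def aE(2) \<phi>0)
  also have "\<dots> = integral\<^sup>L lborel (\<lambda>x. - (a x * laplacian z x)) - integral\<^sup>L lborel (\<lambda>x. q x * (\<phi> x)\<^sup>2)"
    using Ig Iq green_identity[OF D(1) \<open>compact K\<close> \<open>K \<subseteq> D\<close> aC(1) a0 zC2] by simp
  also have "\<dots> = integral\<^sup>L lborel (\<lambda>x. - (a x * laplacian z x) - q x * (\<phi> x)\<^sup>2)"
    using Ia Iq by simp
  \<comment> \<open>Only points with z > 0 contribute. There the integrand is at most q (z a -
    \<phi>^2) + \<epsilon> C a, with a \<le> z \<le> W, and the first term is at most 2 \<delta> M'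
    W.\<close>
  also have "\<dots> \<le> integral\<^sup>L lborel (\<lambda>x. (2 * \<delta> * (M' * W) + \<epsilon> * (C * W)) * indicator (closure D) x)"
  proof (rule integral_mono)
    show "integrable lborel (\<lambda>x. - (a x * laplacian z x) - q x * (\<phi> x)\<^sup>2)"
      using Ia Iq by simp
    show "integrable lborel (\<lambda>x. (2 * \<delta> * (M' * W) + \<epsilon> * (C * W)) * indicator (closure D) x)"
      using borel_integrable_compact[OF cD, of "\<lambda>_. 2 * \<delta> * (M' * W) + \<epsilon> * (C * W)"] by (simp add: mult.commute)
    fix x :: "real^'n"
    have nn: "2 * \<delta> * (M' * W) + \<epsilon> * (C * W) \<ge> 0"
      using \<open>\<delta> > 0\<close> \<open>\<epsilon> > 0\<close> \<open>M' \<ge> 0\<close> \<open>W \<ge> 0\<close> \<open>C \<ge> 0\<close> by simp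
    show "- (a x * laplacian z x) - q x * (\<phi> x)\<^sup>2 \<le> (2 * \<delta> * (M' * W) + \<epsilon> * (C * W)) * indicator (closure D) x"
    proof (cases "x \<in> K \<and> z x > 0")
      case True
      then have x: "x \<in> K" "x \<in> D" "z x > 0" "x \<in> closure D" using \<open>K \<subseteq> D\<close> by (auto simp: K_def)
      note b = smooth_pos_bounds[OF \<open>\<delta> > 0\<close>, of "z x"]
      have "w x > 0" using x(1) \<open>\<epsilon> > 0\<close> by (auto simp: K_def)
      have "- laplacian z x \<le> q x * z x + \<epsilon> * C"
      proof -
        have "\<epsilon> * laplacian \<psi> x \<le> \<epsilon> * (C - q x * \<psi> x)"
          using psil[OF x(2)] \<open>\<epsilon> > 0\<close> by (intro mult_left_mono) auto
        then show ?thesis using zlap[OF x(2)] wl[OF x(2) \<open>w x > 0\<close>] by (simp add: z_def algebra_simps)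
      qed
      from mult_left_mono[OF this b(3)]
      have "- (smooth_pos_prim \<delta> (z x) * laplacian z x) - q x * (smooth_pos \<delta> (z x))\<^sup>2
          \<le> q x * (z x * smooth_pos_prim \<delta> (z x) - (smooth_pos \<delta> (z x))\<^sup>2) + \<epsilon> * (C * smooth_pos_prim \<delta> (z x))"
        by (simp add: algebra_simps)
      moreover have "q x * (z x * smooth_pos_prim \<delta> (z x) - (smooth_pos \<delta> (z x))\<^sup>2) \<le> M' * (2 * \<delta> * W)"
      proof -
        have "\<bar>z x * smooth_pos_prim \<delta> (z x) - (smooth_pos \<delta> (z x))\<^sup>2\<bar> \<le> 2 * \<delta> * W"
          using b(5) x(3) zW[OF x(2)] \<open>\<delta> > 0\<close> mult_left_mono[of "z x" W "2 * \<delta>"] by linarith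
        then have "\<bar>q x * (z x * smooth_pos_prim \<delta> (z x) - (smooth_pos \<delta> (z x))\<^sup>2)\<bar> \<le> M' * (2 * \<delta> * W)"
          unfolding abs_mult using M'(1)[OF x(1)] \<open>M' \<ge> 0\<close> by (intro mult_mono) auto
        then show ?thesis by simp
      qed
      moreover have "\<epsilon> * (C * smooth_pos_prim \<delta> (z x)) \<le> \<epsilon> * (C * W)"
        using b(4) x(3) zW[OF x(2)] \<open>\<epsilon> > 0\<close> \<open>C \<ge> 0\<close> by (intro mult_left_mono) auto
      ultimately show ?thesis using x(1,4) by (simp add: a_def \<phi>_def algebra_simps)
    next
      case False
      then have "a x = 0" "\<phi> x = 0" using smooth_pos_0 by (auto simp: a_def \<phi>_def not_less)
      then show ?thesis using nn by (simp add: indicator_def)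
    qed
  qed
  also have "\<dots> = (2 * \<delta> * (M' * W) + \<epsilon> * (C * W)) * V"
    by (simp add: V_def)
  also have "\<dots> = 2 * \<delta> * (M' * W * V) + \<epsilon> * (C * W * V)"
    by (simp add: algebra_simps)
  also have "\<dots> \<le> \<beta> / 2" using dM eC by simp
  finally have up: "integral \<Omega> (\<lambda>x. grad_sq \<phi> x - q x * (\<phi> x)\<^sup>2) \<le> \<beta> / 2" .
  have "(\<eta> / 2)\<^sup>2 * measure lborel (ball x0 r) = integral\<^sup>L lborel (\<lambda>x. (\<eta> / 2)\<^sup>2 * indicator (ball x0 r) x)"
    by simp
  also have "\<dots> \<le> integral\<^sup>L lborel (\<lambda>x. (\<phi> x)\<^sup>2)"
  proof (rule integral_mono[OF _ I2(1)])
    show "integrable lborel (\<lambda>x. (\<eta> / 2)\<^sup>2 * indicator (ball x0 r) x :: real)"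
      using emeasure_lborel_ball_finite[of x0 r] by (simp add: less_top)
    fix x :: "real^'n"
    show "(\<eta> / 2)\<^sup>2 * indicator (ball x0 r) x \<le> (\<phi> x)\<^sup>2"
    proof (cases "x \<in> ball x0 r")
      case True
      have "\<phi> x = smooth_pos \<delta> (z x)" using \<phi>D r(2) True by auto
      moreover have "\<delta> \<le> \<eta> / 2" unfolding \<delta>_def by (rule min.cobounded1)
      ultimately have "\<phi> x \<ge> \<eta> / 2"
        using smooth_pos_bounds(1)[OF \<open>\<delta> > 0\<close>, of "z x"] zlow[OF True] by simp
      then have "(\<eta> / 2)\<^sup>2 \<le> (\<phi> x)\<^sup>2" using \<open>\<eta> > 0\<close> by (intro power_mono) auto
      then show ?thesis using True by simp
    qed simp
  qed
  finally have "\<beta> \<le> c * integral \<Omega> (\<lambda>x. (\<phi> x)\<^sup>2)"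
    using \<open>c > 0\<close> by (simp add: \<beta>_def I2(2))
  also have "\<dots> \<le> \<beta> / 2"
    using stab[OF \<phi>E(1) csupp subset_trans[OF supp K\<Omega>]] up by linarith
  finally show False using \<open>\<beta> > 0\<close> by simp
qed

section \<open>Comparison of a stable solution with its images under isometries\<close>

text \<open>A Householder reflection. For a = 0 division by zero gives 0 and the map is the
  identity, a case that occurs in \<open>radial_neg\<close>.\<close>

lemma reflect_along_orthogonal:
  fixes a :: "real^'n::finite"
  obtains A :: "real^'n^'n" where "orthogonal_matrix A" "\<And>x. A *v x = x - (2 * (x \<bullet> a) / (a \<bullet> a)) *\<^sub>R a"
proof -
  define T where "T x = x - (2 * (x \<bullet> a) / (a \<bullet> a)) *\<^sub>R a" for x
  have lT: "linear T" unfolding T_def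
    by (auto intro!: linearI simp: inner_simps algebra_simps add_divide_distrib)
  have "T x \<bullet> T y = x \<bullet> y" for x y
    by (cases "a = 0") (simp_all add: T_def inner_simps inner_commute field_simps)
  then have "orthogonal_transformation T"
    using lT by (simp add: orthogonal_transformation_def)
  then have "orthogonal_matrix (matrix T)" by (simp add: orthogonal_transformation_matrix)
  moreover have "matrix T *v x = T x" for x
    using lT by (intro matrix_works) (simp add: linear_def scalar_mult_eq_scaleR[abs_def])
  ultimately show thesis using that by (simp add: T_def)
qed

lemma reflect_matrix:
  fixes i :: "'n::finite"
  obtains A :: "real^'n^'n" where "orthogonal_matrix A" "\<And>x. A *v x = reflect i x"
proof -
  obtain A :: "real^'n^'n" where "orthogonal_matrix A"
    "\<And>x. A *v x = x - (2 * (x \<bullet> axis i 1) / (axis i 1 \<bullet> axis i (1::real))) *\<^sub>R axis i 1"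
    by (rule reflect_along_orthogonal[of "axis i 1"]) auto
  then show thesis by (intro that[of A]) (auto simp: reflect_def inner_axis)
qed

definition set_coord :: "'n::finite \<Rightarrow> real \<Rightarrow> real^'n \<Rightarrow> real^'n" where
  "set_coord i t x = x + (t - x $ i) *\<^sub>R axis i 1"

lemma set_coord_nth [simp]: "set_coord i t x $ j = (if j = i then t else x $ j)"
  by (auto simp: set_coord_def axis_def)

lemma reflect_nth [simp]: "reflect i x $ j = (if j = i then - x $ i else x $ j)"
  by (auto simp: reflect_def axis_def)

lemma reflect_reflect [simp]: "reflect i (reflect i x) = x"
  by (simp add: vec_eq_iff)

lemma orthogonal_matrix_inner:
  fixes A :: "real^'n::finite^'n"
  assumes "orthogonal_matrix A" shows "(A *v x) \<bullet> (A *v y) = x \<bullet> y"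
proof -
  have "orthogonal_transformation (\<lambda>x. A *v x)"
    using assms by (simp add: orthogonal_transformation_matrix)
  then show ?thesis by (simp add: orthogonal_transformation_def)
qed

lemma orthogonal_matrix_transpose_cancel:
  fixes A :: "real^'n::finite^'n"
  assumes "orthogonal_matrix A"
  shows "A *v (transpose A *v y) = y" "transpose A *v (A *v y) = y"
  unfolding matrix_vector_mul_assoc using assms by (simp_all add: orthogonal_matrix_def)

text \<open>Links the two descriptions of rotational symmetry: by matrices for the domain, by |x'|
  and \<open>x $ k\<close> for f.\<close>

lemma orthogonal_fixing_axis:
  fixes A :: "real^'n::finite^'n"
  assumes "orthogonal_matrix A" "A *v axis k 1 = axis k 1"
  shows "(A *v x) $ k = x $ k" "norm (xprime k (A *v x)) = norm (xprime k x)"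
proof -
  have "(A *v x) \<bullet> (A *v axis k 1) = x \<bullet> axis k 1" by (rule orthogonal_matrix_inner[OF assms(1)])
  then show k: "(A *v x) $ k = x $ k" using assms(2) by (simp add: inner_axis)
  have "xprime k (A *v x) = A *v (xprime k x)"
    by (simp add: xprime_def k matrix_vector_mult_diff_distrib matrix_vector_mult_scaleR assms(2))
  then show "norm (xprime k (A *v x)) = norm (xprime k x)"
    by (simp add: norm_eq_sqrt_inner orthogonal_matrix_inner[OF assms(1)])
qed

section \<open>The setting; consequences of the assumptions on the domain and on f\<close>

locale stable_solution =
  fixes \<Omega> :: "(real^'n::finite) set" and k :: 'n
    and f :: "real^'n \<Rightarrow> real \<Rightarrow> real" and u :: "real^'n \<Rightarrow> real"
  assumes dom: "domain \<Omega>" and bdd: "bounded \<Omega>"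
    and srs: "simple_rot_sym k \<Omega>"
    and f_reg: "C11_on (\<Omega> \<times> UNIV) (\<lambda>(x, s). f x s)"
    and f_conv: "\<forall>x\<in>\<Omega>. convex_on UNIV (f x)"
    and f_even: "\<forall>x\<in>\<Omega>. \<forall>s. f (reflect k x) s = f x s"
    and f_rad: "\<forall>x\<in>\<Omega>. \<forall>y\<in>\<Omega>. \<forall>s. y $ k = x $ k \<and> norm (xprime k y) = norm (xprime k x)
                  \<longrightarrow> f y s = f x s"
    and f_decr: "\<forall>i. \<forall>x a c s. x $ i = 0 \<and> 0 < a \<and> a \<le> c \<and>
                  x + a *\<^sub>R axis i 1 \<in> \<Omega> \<and> x + c *\<^sub>R axis i 1 \<in> \<Omega>
                  \<longrightarrow> f (x + c *\<^sub>R axis i 1) s \<le> f (x + a *\<^sub>R axis i 1) s"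
    and u_reg: "C2_on \<Omega> u" and u_cont: "continuous_on (closure \<Omega>) u"
    and u_eq: "\<forall>x\<in>\<Omega>. - laplacian u x = f x (u x)"
    and u_bd: "\<forall>x\<in>frontier \<Omega>. u x = 0"
    and u_pos: "\<forall>x\<in>\<Omega>. u x > 0"
    and u_stable: "stable \<Omega> f u"
begin

lemma open_dom: "open \<Omega>" and nonempty: "\<Omega> \<noteq> {}"
  using dom by (auto simp: domain_def)

lemma matrix_mem:
  assumes "orthogonal_matrix A" "A *v axis k 1 = axis k 1" "x \<in> \<Omega>"
  shows "A *v x \<in> \<Omega>" "f (A *v x) s = f x s"
proof -
  show m: "A *v x \<in> \<Omega>" using srs assms by (auto simp: simple_rot_sym_def)
  show "f (A *v x) s = f x s"
    using f_rad assms m orthogonal_fixing_axis[OF assms(1,2), of x] by blast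
qed

lemma reflect_mem:
  assumes "x \<in> \<Omega>"
  shows "reflect i x \<in> \<Omega>" "f (reflect i x) s = f x s"
proof -
  have "reflect i x \<in> \<Omega> \<and> f (reflect i x) s = f x s"
  proof (cases "i = k")
    case True
    then show ?thesis using srs f_even assms by (auto simp: simple_rot_sym_def)
  next
    case False
    obtain A :: "real^'n^'n" where A: "orthogonal_matrix A" "\<And>x. A *v x = reflect i x"
      by (rule reflect_matrix[of i]) auto
    have "A *v axis k 1 = axis k 1" unfolding A(2) using False by (simp add: vec_eq_iff axis_def)
    from matrix_mem[OF A(1) this assms] show ?thesis by (simp add: A(2))
  qed
  then show "reflect i x \<in> \<Omega>" "f (reflect i x) s = f x s" by auto
qed

text \<open>Axis convexity applied to x and its mirror image \<open>reflect i x\<close>, whose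
  segment contains all smaller values of the i-th coordinate.\<close>

lemma set_coord_mem:
  assumes "x \<in> \<Omega>" "\<bar>t\<bar> \<le> \<bar>x $ i\<bar>"
  shows "set_coord i t x \<in> \<Omega>"
proof -
  have "x - reflect i x = (2 * x $ i) *\<^sub>R axis i 1" by (simp add: reflect_def)
  then have sub: "closed_segment (reflect i x) x \<subseteq> \<Omega>"
    using srs reflect_mem(1)[OF assms(1)] assms(1) unfolding simple_rot_sym_def axis_convex_def by blast
  show ?thesis
  proof (cases "x $ i = 0")
    case True
    then have "set_coord i t x = x" using assms(2) by (simp add: vec_eq_iff)
    then show ?thesis using assms by simp
  next
    case False
    \<comment> \<open>Solves (2 m - 1) \<open>x $ i\<close> = t.\<close>
    define m where "m = (t / x $ i + 1) / 2"
    have "\<bar>t / x $ i\<bar> \<le> 1" using assms(2) False by simp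
    from abs_le_D1[OF this] abs_le_D2[OF this] have m: "0 \<le> m" "m \<le> 1" by (auto simp: m_def)
    have "set_coord i t x = (1 - m) *\<^sub>R reflect i x + m *\<^sub>R x"
      using False by (simp add: vec_eq_iff m_def field_simps)
    then have "set_coord i t x \<in> closed_segment (reflect i x) x"
      using m by (auto simp: in_segment)
    then show ?thesis using sub by blast
  qed
qed

lemma f_differentiable:
  assumes "x \<in> \<Omega>" shows "(\<lambda>(x, s). f x s) differentiable (at (x, s))"
  using f_reg assms by (auto simp: C11_on_def C1_on_def)

lemma f_deriv:
  assumes "x \<in> \<Omega>" shows "(f x has_real_derivative deriv (f x) s) (at s)"
proof -
  have "(\<lambda>s. (x, s)) differentiable (at s)"
    by (auto simp: differentiable_def intro!: exI derivative_intros)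
  with f_differentiable[OF assms, of s] have "(\<lambda>s. (\<lambda>(x, s). f x s) (x, s)) differentiable (at s)"
    using differentiable_compose[of "\<lambda>(x, s). f x s" "\<lambda>s. (x, s)" s UNIV] by simp
  then show ?thesis
    by (simp add: DERIV_deriv_iff_real_differentiable)
qed

lemma f_cont: "x \<in> \<Omega> \<Longrightarrow> isCont (\<lambda>x. f x s) x"
proof -
  assume "x \<in> \<Omega>"
  then have "isCont (\<lambda>(x, s). f x s) (x, s)"
    by (intro differentiable_imp_continuous_within f_differentiable)
  moreover have "isCont (\<lambda>x. (x, s)) x" by (intro continuous_intros)
  ultimately show "isCont (\<lambda>x. f x s) x" using isCont_o2[of x "\<lambda>x. (x, s)" "\<lambda>(x, s). f x s"] by simp
qed

text \<open>The monotonicity assumption compares strictly positive coordinates only. Evenness in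
  each coordinate covers negative values, and t = 0 is reached as a limit from the right.\<close>

lemma f_set_coord:
  assumes "x \<in> \<Omega>" "\<bar>t\<bar> \<le> \<bar>x $ i\<bar>"
  shows "f x s \<le> f (set_coord i t x) s"
proof -
  have pos: "f (set_coord i c x) s \<le> f (set_coord i a x) s"
    if "0 < a" "a \<le> c" "c \<le> \<bar>x $ i\<bar>" for a c
  proof -
    have e: "set_coord i 0 x + b *\<^sub>R axis i 1 = set_coord i b x" for b
      by (simp add: set_coord_def algebra_simps)
    show ?thesis
      using f_decr[rule_format, of "set_coord i 0 x" i a c s] that
        set_coord_mem[OF assms(1), of a i] set_coord_mem[OF assms(1), of c i]
      by (auto simp: e)
  qed
  have sym: "f (set_coord i \<bar>a\<bar> x) s = f (set_coord i a x) s" if "\<bar>a\<bar> \<le> \<bar>x $ i\<bar>" for a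
  proof (cases "a \<ge> 0")
    case False
    then have "set_coord i \<bar>a\<bar> x = reflect i (set_coord i a x)" by (simp add: vec_eq_iff)
    then show ?thesis using reflect_mem(2)[OF set_coord_mem[OF assms(1) that]] by simp
  qed simp
  have x: "set_coord i (x $ i) x = x" by (simp add: vec_eq_iff)
  show ?thesis
  proof (cases "t = 0")
    case False
    then show ?thesis using pos[of "\<bar>t\<bar>" "\<bar>x $ i\<bar>"] assms(2) sym[of t] sym[of "x $ i"] x by simp
  next
    case True
    show ?thesis
    proof (cases "x $ i = 0")
      case True
      then show ?thesis using \<open>t = 0\<close> x by simp
    next
      case False
      have "isCont (\<lambda>a. set_coord i a x) 0" unfolding set_coord_def by (intro continuous_intros)
      moreover have "isCont (\<lambda>x. f x s) (set_coord i 0 x)"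
        by (rule f_cont[OF set_coord_mem[OF assms(1)]]) simp
      ultimately have "isCont (\<lambda>a. f (set_coord i a x) s) 0"
        using isCont_o2[of 0 "\<lambda>a. set_coord i a x" "\<lambda>x. f x s"] by simp
      then have "((\<lambda>a. f (set_coord i a x) s) \<longlongrightarrow> f (set_coord i 0 x) s) (at_right 0)"
        by (simp add: isCont_def filterlim_at_split)
      moreover have "\<forall>\<^sub>F a in at_right 0. f x s \<le> f (set_coord i a x) s"
        unfolding eventually_at_right_field
      proof (intro exI[of _ "\<bar>x $ i\<bar>"] conjI allI impI)
        show "0 < \<bar>x $ i\<bar>" using False by simp
        fix a assume "0 < a" "a < \<bar>x $ i\<bar>"
        then show "f x s \<le> f (set_coord i a x) s"
          using pos[of a "\<bar>x $ i\<bar>"] sym[of "x $ i"] x by simp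
      qed
      ultimately have "f x s \<le> f (set_coord i 0 x) s"
        by (intro tendsto_lowerbound) auto
      then show ?thesis using True by simp
    qed
  qed
qed

text \<open>The coordinates are set to zero one at a time. The bound by f at the origin replaces a
  bound of f x s up to the boundary, which the regularity of f inside \<Omega> does not
  provide.\<close>

lemma zero_mem_bound:
  assumes "x \<in> \<Omega>"
  shows "0 \<in> \<Omega>" "f x s \<le> f 0 s"
proof -
  define Z where "Z J = (\<chi> i. if i \<in> J then 0 else x $ i)" for J
  have "Z J \<in> \<Omega> \<and> f x s \<le> f (Z J) s" if "finite J" for J
    using that
  proof (induction J rule: finite_induct)
    case empty
    have "Z {} = x" by (simp add: Z_def vec_eq_iff)
    then show ?case using assms by simp
  next
    case (insert i J)
    have "Z (insert i J) = set_coord i 0 (Z J)" by (simp add: Z_def vec_eq_iff)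
    then show ?case
      using insert set_coord_mem[of "Z J" 0 i] f_set_coord[of "Z J" 0 i s] by auto
  qed
  moreover have "Z UNIV = 0" by (simp add: Z_def vec_eq_iff)
  ultimately show "0 \<in> \<Omega>" "f x s \<le> f 0 s" using finite[of "UNIV :: 'n set"] by metis+
qed

section \<open>The linearized potential, comparison, and symmetry of the solution\<close>

definition q :: "real^'n \<Rightarrow> real" where "q x = deriv (f x) (u x)"

lemma f_convex: "x \<in> \<Omega> \<Longrightarrow> f x (u x) + q x * (s - u x) \<le> f x s"
  using convex_on_imp_above_tangent[of UNIV "f x" "u x" s "q x"] f_conv f_deriv[of x "u x"]
  by (simp add: q_def algebra_simps)

lemma u_C1: "C1_on \<Omega> u" by (rule C2_onD(1)[OF u_reg])

lemma q_cont: "continuous_on \<Omega> q"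
proof -
  have "dderiv (\<lambda>(x, s). f x s) (0, 1) (x, s) = deriv (f x) s" if "x \<in> \<Omega>" for x s
  proof -
    have "((\<lambda>t. f x (s + t)) has_real_derivative deriv (f x) s) (at 0)"
      using f_deriv[OF that, of s] DERIV_shift[of "f x" "deriv (f x) s" 0 s] by (simp add: add.commute[of s])
    then show ?thesis by (simp add: dderiv_def DERIV_imp_deriv)
  qed
  moreover have "(0, 1) \<in> (Basis :: ((real^'n) \<times> real) set)" by (simp add: Basis_prod_def)
  then have "continuous_on (\<Omega> \<times> UNIV) (dderiv (\<lambda>(x, s). f x s) (0, 1))"
    using f_reg by (auto simp: C11_on_def C1_on_def)
  then have "continuous_on \<Omega> (\<lambda>x. dderiv (\<lambda>(x, s). f x s) (0, 1) (x, u x))"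
    by (rule continuous_on_compose2) (auto intro!: continuous_intros C1_on_cont[OF u_C1])
  ultimately show ?thesis unfolding q_def[abs_def] by (simp cong: continuous_on_cong)
qed

lemma closure_dom: "closure \<Omega> = \<Omega> \<union> frontier \<Omega>"
  using closure_Un_frontier by blast

lemma u_nonneg: "x \<in> closure \<Omega> \<Longrightarrow> u x \<ge> 0"
  using u_pos u_bd by (force simp: closure_dom)

text \<open>Convexity shows that \<open>S - u\<close> is, up to a constant, a supersolution of the linearized equation.\<close>

lemma supersolution:
  obtains \<psi> C where "C2_on \<Omega> \<psi>" "\<And>x. x \<in> \<Omega> \<Longrightarrow> \<psi> x \<ge> 1" "C \<ge> 0"
    "\<And>x. x \<in> \<Omega> \<Longrightarrow> - laplacian \<psi> x - q x * \<psi> x \<ge> - C"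
proof -
  have "compact (closure \<Omega>)" using bdd by (simp add: compact_closure)
  then have "bounded (u ` closure \<Omega>)"
    by (intro compact_imp_bounded compact_continuous_image u_cont)
  then obtain M where M: "\<And>x. x \<in> closure \<Omega> \<Longrightarrow> \<bar>u x\<bar> \<le> M"
    unfolding bounded_iff by fastforce
  define S where "S = M + 1"
  define \<psi> where "\<psi> = (\<lambda>x. (-1) * u x + 0 * u x + S)"
  note L = C2_on_lincomb[OF open_dom u_reg u_reg, where a = "-1" and b = 0 and c = S, folded \<psi>_def]
  show thesis
  proof (rule that[of \<psi> "\<bar>f 0 S\<bar>"])
    fix x assume x: "x \<in> \<Omega>"
    then show "\<psi> x \<ge> 1" using M[of x] closure_subset[of \<Omega>] by (auto simp: \<psi>_def S_def abs_le_iff)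
    have "- laplacian \<psi> x - q x * \<psi> x = - f x (u x) - q x * (S - u x)"
      using L(2)[OF x] u_eq x by (auto simp: \<psi>_def algebra_simps)
    then show "- laplacian \<psi> x - q x * \<psi> x \<ge> - \<bar>f 0 S\<bar>"
      using f_convex[OF x, of S] zero_mem_bound(2)[OF x, of S] by linarith
  qed (use L in auto)
qed

text \<open>Stability makes the moving plane procedure unnecessary.\<close>

lemma comparison:
  fixes A :: "real^'n^'n" and b :: "real^'n"
  defines "T \<equiv> \<lambda>x. A *v x + b"
  assumes A: "orthogonal_matrix A" and D: "open D" "D \<subseteq> \<Omega>" "T ` D \<subseteq> \<Omega>"
    and fT: "\<And>x s. x \<in> D \<Longrightarrow> f x s \<le> f (T x) s"
    and bd: "\<And>x. x \<in> frontier D \<Longrightarrow> x \<in> frontier \<Omega> \<or> T x = x"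
  shows "C2_on D (\<lambda>x. u x - u (T x))"
    "x \<in> D \<Longrightarrow> - laplacian (\<lambda>x. u x - u (T x)) x \<le> q x * (u x - u (T x))"
    "x \<in> D \<Longrightarrow> u x \<le> u (T x)"
proof -
  note I = C2_on_isometry[OF u_reg A D(1), of b, folded T_def, OF D(3)]
  note L = C2_on_lincomb[OF D(1) C2_on_subset[OF u_reg D(2)] I(1), where a = 1 and b = "-1" and c = 0]
  show w: "C2_on D (\<lambda>x. u x - u (T x))" using L(1) by (simp add: T_def)
  show wl: "- laplacian (\<lambda>x. u x - u (T x)) x \<le> q x * (u x - u (T x))" if "x \<in> D" for x
  proof -
    have "T x \<in> \<Omega>" "x \<in> \<Omega>" using D that by auto
    then have "- laplacian (\<lambda>x. u x - u (T x)) x = f x (u x) - f (T x) (u (T x))"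
      using L(2)[OF that] I(2)[OF that] u_eq by (simp add: T_def)
    \<comment> \<open>Two inequalities in turn: \<open>fT\<close> replaces T x by x in the first
      argument of f, then the tangent at u x replaces the difference of f x by q times the
      difference of u.\<close>
    then show ?thesis using fT[OF that, of "u (T x)"] f_convex[OF \<open>x \<in> \<Omega>\<close>, of "u (T x)"]
      by (simp add: algebra_simps)
  qed
  obtain \<psi> C where psi: "C2_on \<Omega> \<psi>" "\<And>x. x \<in> \<Omega> \<Longrightarrow> \<psi> x \<ge> 1" "C \<ge> 0"
    "\<And>x. x \<in> \<Omega> \<Longrightarrow> - laplacian \<psi> x - q x * \<psi> x \<ge> - C"
    by (rule supersolution) blast
  have cT: "continuous_on X T" for X unfolding T_def by (intro continuous_intros)
  have Tcl: "T ` closure D \<subseteq> closure \<Omega>"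
    using image_closure_subset[OF cT closed_closure, of D \<Omega>] D(3) closure_subset by blast
  have Dcl: "closure D \<subseteq> closure \<Omega>" using D(2) by (rule closure_mono)
  obtain c where c: "c > 0" "\<And>\<phi>. C1_on UNIV \<phi> \<Longrightarrow> compact (closure {x. \<phi> x \<noteq> 0}) \<Longrightarrow> closure {x. \<phi> x \<noteq> 0} \<subseteq> \<Omega> \<Longrightarrow>
      integral \<Omega> (\<lambda>x. grad_sq \<phi> x - q x * (\<phi> x)\<^sup>2) \<ge> c * integral \<Omega> (\<lambda>x. (\<phi> x)\<^sup>2)"
    using u_stable unfolding stable_def q_def by blast
  show "u x \<le> u (T x)" if "x \<in> D"
  proof -
    have "u x - u (T x) \<le> 0"
    proof (rule stable_maximum_principle[OF c(2) c(1) bdd q_cont D(1,2) w _ _ wl C2_on_subset[OF psi(1) D(2)] _ _ psi(3) that])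
      show "continuous_on (closure D) (\<lambda>x. u x - u (T x))"
        by (intro continuous_intros continuous_on_compose2[OF u_cont cT Tcl] continuous_on_subset[OF u_cont Dcl])
      \<comment> \<open>Either x is on \<open>frontier \<Omega>\<close>, where u x = 0 and u (T x)
        \<ge> 0, or T fixes x.\<close>
      show "u x - u (T x) \<le> 0" if "x \<in> frontier D" for x
      proof -
        have "x \<in> closure D" using that by (simp add: frontier_def)
        then have "u (T x) \<ge> 0" using Tcl by (intro u_nonneg) auto
        then show ?thesis using bd[OF that] u_bd by auto
      qed
    qed (use psi D in auto)
    then show ?thesis by simp
  qed
qed

text \<open>Comparison on all of \<Omega> for A and for its inverse gives opposite inequalities, the
  second one evaluated at A x.\<close>

lemma invariant:
  fixes A :: "real^'n^'n"
  assumes A: "orthogonal_matrix A" and mem: "\<And>x. x \<in> \<Omega> \<Longrightarrow> A *v x \<in> \<Omega>" "\<And>x. x \<in> \<Omega> \<Longrightarrow> transpose A *v x \<in> \<Omega>"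
    and f: "\<And>x s. x \<in> \<Omega> \<Longrightarrow> f (A *v x) s = f x s"
    and x: "x \<in> \<Omega>"
  shows "u (A *v x) = u x"
proof -
  note AT = orthogonal_matrix_transpose_cancel[OF A]
  have f': "f (transpose A *v x) s = f x s" if "x \<in> \<Omega>" for x s
    using f[OF mem(2)[OF that]] AT(1)[of x] by metis
  have 1: "u x \<le> u (A *v x)" if "x \<in> \<Omega>" for x
    using comparison(3)[OF A open_dom, of 0 x] mem f that by auto
  have 2: "u x \<le> u (transpose A *v x)" if "x \<in> \<Omega>" for x
    using comparison(3)[of "transpose A" \<Omega> 0 x] A open_dom mem f' that by auto
  show ?thesis using 1[OF x] 2[OF mem(1)[OF x]] unfolding AT(2) by simp
qed

lemma rotation_invariant:
  fixes A :: "real^'n^'n"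
  assumes "orthogonal_matrix A" "A *v axis k 1 = axis k 1" "x \<in> \<Omega>"
  shows "u (A *v x) = u x"
proof (rule invariant)
  have "transpose A *v axis k 1 = axis k 1"
    using orthogonal_matrix_transpose_cancel(2)[OF assms(1), of "axis k 1"] assms(2) by simp
  then show "\<And>x. x \<in> \<Omega> \<Longrightarrow> transpose A *v x \<in> \<Omega>" using assms(1) by (intro matrix_mem) auto
qed (use assms matrix_mem in auto)

lemma reflect_invariant:
  assumes "x \<in> \<Omega>" shows "u (reflect i x) = u x"
proof -
  obtain A :: "real^'n^'n" where A: "orthogonal_matrix A" "\<And>x. A *v x = reflect i x"
    by (rule reflect_matrix[of i]) auto
  have T: "transpose A *v y = reflect i y" for y
    using orthogonal_matrix_transpose_cancel(2)[OF A(1), of "reflect i y"] by (simp add: A(2))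
  show ?thesis
    using invariant[OF A(1), of x, unfolded T A(2)] reflect_mem assms by blast
qed

lemma partial_isometry:
  fixes A :: "real^'n^'n"
  assumes inv: "\<And>x. x \<in> \<Omega> \<Longrightarrow> A *v x \<in> \<Omega> \<and> u (A *v x) = u x" and x: "x \<in> \<Omega>"
  shows "dderiv u v x = dderiv u (A *v v) (A *v x)"
proof -
  have "((\<lambda>x. A *v x) has_derivative (\<lambda>h. A *v h)) (at x)"
    by (auto intro!: bounded_linear_imp_has_derivative)
  from has_derivative_compose[OF this C1_on_deriv[OF u_C1]] inv x
  have "((\<lambda>x. u (A *v x)) has_derivative (\<lambda>h. grad u (A *v x) \<bullet> (A *v h))) (at x)" by blast
  from has_derivative_cong_open[OF open_dom x _ this] inv
  have "(u has_derivative (\<lambda>h. grad u (A *v x) \<bullet> (A *v h))) (at x)" by simp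
  then have "dderiv u v x = grad u (A *v x) \<bullet> (A *v v)" by (rule dderiv_eq)
  also have "\<dots> = dderiv u (A *v v) (A *v x)"
    using dderiv_eq[OF C1_on_deriv[OF u_C1]] inv x by simp
  finally show ?thesis .
qed

lemma partial_reflect:
  assumes "x \<in> \<Omega>" shows "partial i u (reflect i x) = - partial i u x"
proof -
  obtain A :: "real^'n^'n" where A: "orthogonal_matrix A" "\<And>x. A *v x = reflect i x"
    by (rule reflect_matrix[of i]) auto
  have e: "reflect i (axis i 1) = - axis i 1" by (simp add: vec_eq_iff axis_def)
  have "partial i u x = dderiv u (- axis i 1) (reflect i x)"
    using partial_isometry[of A x "axis i 1"] assms reflect_mem(1) reflect_invariant
    by (simp add: A(2) partial_dderiv e)
  also have "\<dots> = - partial i u (reflect i x)"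
    using dderiv_eq[OF C1_on_deriv[OF u_C1 reflect_mem(1)[OF assms]]] by (simp add: partial_dderiv)
  finally show ?thesis by simp
qed

lemma partial_zero:
  assumes "x \<in> \<Omega>" "x $ i = 0" shows "partial i u x = 0"
proof -
  have "reflect i x = x" using assms(2) by (simp add: vec_eq_iff)
  then show ?thesis using partial_reflect[OF assms(1), of i] by simp
qed

section \<open>Monotonicity and the critical point\<close>

definition plane_diff :: "'n \<Rightarrow> real \<Rightarrow> real^'n \<Rightarrow> real" where
  "plane_diff i \<mu> x = u x - u (set_coord i (2 * \<mu> - x $ i) x)"

lemma set_coord_reflect: "set_coord i (2 * \<mu> - x $ i) x = reflect i x + (2 * \<mu>) *\<^sub>R axis i 1"
  by (auto simp: vec_eq_iff axis_def)

lemma open_cap: "open {x \<in> \<Omega>. x $ i > \<mu>}"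
proof -
  have "open {x :: real^'n. \<mu> < x $ i}" by (intro open_Collect_less continuous_intros)
  then have "open (\<Omega> \<inter> {x. \<mu> < x $ i})" using open_dom by blast
  then show ?thesis by (simp add: Int_def)
qed

text \<open>For \<mu> \<ge> 0 reflecting the cap lowers |x_i|, so the image stays in \<Omega> by
  axis convexity and f does not decrease. A frontier point of the cap is on
  \<open>frontier \<Omega>\<close> or on the plane, which the reflection fixes.\<close>

lemma cap_comparison:
  assumes "0 \<le> \<mu>"
  shows "C2_on {x \<in> \<Omega>. x $ i > \<mu>} (plane_diff i \<mu>)"
    "x \<in> \<Omega> \<Longrightarrow> x $ i > \<mu> \<Longrightarrow> - laplacian (plane_diff i \<mu>) x \<le> q x * plane_diff i \<mu> x"
    "x \<in> \<Omega> \<Longrightarrow> x $ i > \<mu> \<Longrightarrow> plane_diff i \<mu> x \<le> 0"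
proof -
  let ?D = "{x \<in> \<Omega>. x $ i > \<mu>}"
  obtain A :: "real^'n^'n" where A: "orthogonal_matrix A" "\<And>x. A *v x = reflect i x"
    by (rule reflect_matrix[of i]) auto
  have T: "A *v x + (2 * \<mu>) *\<^sub>R axis i 1 = set_coord i (2 * \<mu> - x $ i) x" for x
    by (simp add: A(2) set_coord_reflect)
  have abs: "\<bar>2 * \<mu> - x $ i\<bar> \<le> \<bar>x $ i\<bar>" if "x \<in> ?D" for x using that \<open>0 \<le> \<mu>\<close> by auto
  have fr: "x \<in> frontier \<Omega> \<or> set_coord i (2 * \<mu> - x $ i) x = x" if "x \<in> frontier ?D" for x
  proof (cases "x \<in> \<Omega>")
    case True
    have x: "x \<in> closure ?D" "x \<notin> ?D"
      using that open_cap[of \<mu> i] by (auto simp: frontier_def interior_open)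
    have "closure ?D \<subseteq> {x. \<mu> \<le> x $ i}"
      by (intro closure_minimal closed_Collect_le continuous_intros) auto
    then have "x $ i = \<mu>" using x True by auto
    then show ?thesis by (simp add: vec_eq_iff)
  next
    case False
    have "closure ?D \<subseteq> closure \<Omega>" by (intro closure_mono) auto
    then have "x \<in> closure \<Omega>" using that by (auto simp: frontier_def)
    then show ?thesis using False closure_dom by blast
  qed
  note C = comparison[OF A(1) open_cap[of \<mu> i], of "(2 * \<mu>) *\<^sub>R axis i 1", unfolded T]
  have 1: "?D \<subseteq> \<Omega>" by auto
  have 2: "(\<lambda>x. set_coord i (2 * \<mu> - x $ i) x) ` ?D \<subseteq> \<Omega>" using set_coord_mem abs by auto
  have 3: "f x s \<le> f (set_coord i (2 * \<mu> - x $ i) x) s" if "x \<in> ?D" for x s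
    using f_set_coord abs[OF that] that by blast
  note C' = C[OF 1 2 3 fr]
  show "C2_on ?D (plane_diff i \<mu>)" unfolding plane_diff_def[abs_def] using C'(1) by simp
  show "- laplacian (plane_diff i \<mu>) x \<le> q x * plane_diff i \<mu> x" if "x \<in> \<Omega>" "x $ i > \<mu>"
    unfolding plane_diff_def[abs_def] using C'(2)[of x] that by simp
  show "plane_diff i \<mu> x \<le> 0" if "x \<in> \<Omega>" "x $ i > \<mu>"
    unfolding plane_diff_def using C'(3)[of x] that by simp
qed

text \<open>Regularity across the plane x_i = \<mu>. The Hopf lemma is applied at points of that
  plane, which the open cap omits.\<close>

lemma plane_diff_C2:
  assumes "open S" "S \<subseteq> \<Omega>" "\<And>x. x \<in> S \<Longrightarrow> set_coord i (2 * \<mu> - x $ i) x \<in> \<Omega>"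
  shows "C2_on S (plane_diff i \<mu>)"
proof -
  obtain A :: "real^'n^'n" where A: "orthogonal_matrix A" "\<And>x. A *v x = reflect i x"
    by (rule reflect_matrix[of i]) auto
  have T: "A *v x + (2 * \<mu>) *\<^sub>R axis i 1 = set_coord i (2 * \<mu> - x $ i) x" for x
    by (simp add: A(2) set_coord_reflect)
  have "C2_on S (\<lambda>x. u (set_coord i (2 * \<mu> - x $ i) x))"
    using C2_on_isometry(1)[OF u_reg A(1) assms(1), of "(2 * \<mu>) *\<^sub>R axis i 1", unfolded T] assms(3) by blast
  from C2_on_lincomb(1)[OF assms(1) C2_on_subset[OF u_reg assms(2)] this, where a = 1 and b = "-1" and c = 0]
  show ?thesis by (simp add: plane_diff_def[abs_def])
qed

text \<open>Along the axis through a point of the plane the difference is u (x + t e) - u (x - t e),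
  whose derivative at 0 is doubled.\<close>

lemma partial_plane_diff:
  assumes "C1_on S (plane_diff i \<mu>)" "x \<in> S" "x \<in> \<Omega>" "x $ i = \<mu>"
  shows "partial i (plane_diff i \<mu>) x = 2 * partial i u x"
proof -
  let ?e = "axis i 1 :: real^'n"
  have T: "plane_diff i \<mu> (x + t *\<^sub>R ?e) = u (x + t *\<^sub>R ?e) - u (x + (- t) *\<^sub>R ?e)" for t
  proof -
    have "set_coord i (2 * \<mu> - (x + t *\<^sub>R ?e) $ i) (x + t *\<^sub>R ?e) = x + (- t) *\<^sub>R ?e"
      using assms(4) by (auto simp: vec_eq_iff axis_def)
    then show ?thesis unfolding plane_diff_def by simp
  qed
  have u1: "((\<lambda>t. u (x + t *\<^sub>R ?e)) has_real_derivative partial i u x) (at 0)"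
    using partial_line[OF u_C1, of x 0 i] assms(3) by simp
  then have "((\<lambda>t. u (x + (- t) *\<^sub>R ?e)) has_real_derivative - partial i u x) (at 0)"
    using DERIV_mirror[of "\<lambda>t. u (x + t *\<^sub>R ?e)" "partial i u x" 0] by (simp add: DERIV_minus)
  from DERIV_diff[OF u1 this]
  have "((\<lambda>t. plane_diff i \<mu> (x + t *\<^sub>R ?e)) has_real_derivative 2 * partial i u x) (at 0)"
    unfolding T by simp
  moreover have "((\<lambda>t. plane_diff i \<mu> (x + t *\<^sub>R ?e)) has_real_derivative partial i (plane_diff i \<mu>) x) (at 0)"
    using partial_line[OF assms(1), of x 0 i] assms(2) by simp
  ultimately show ?thesis by (rule DERIV_unique[symmetric])
qed

text \<open>If \<open>plane_diff\<close> vanished at \<open>p\<close>, it would vanish along the ray from \<open>p\<close> in direction \<open>x\<^sub>i\<close> up to the boundary,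
  where \<open>u = 0\<close> while the reflected point is interior.\<close>

lemma cap_strict:
  assumes "0 < \<mu>" "p \<in> \<Omega>" "p $ i > \<mu>"
  shows "plane_diff i \<mu> p < 0"
proof (rule ccontr)
  assume "\<not> plane_diff i \<mu> p < 0"
  let ?D = "{x \<in> \<Omega>. x $ i > \<mu>}" and ?e = "axis i 1 :: real^'n"
  note C = cap_comparison[OF less_imp_le[OF \<open>0 < \<mu>\<close>], where i = i]
  have p0: "plane_diff i \<mu> p = 0" using C(3)[OF assms(2,3)] \<open>\<not> plane_diff i \<mu> p < 0\<close> by simp
  define l where "l t = p + t *\<^sub>R ?e" for t
  have l_i: "l t $ i = p $ i + t" for t by (simp add: l_def)
  have cl: "continuous_on X l" for X unfolding l_def by (intro continuous_intros)
  \<comment> \<open>Its infimum t1 is the exit time of the ray, attained because \<Omega> is open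
    and bounded.\<close>
  define X where "X = {t. 0 \<le> t \<and> l t \<notin> \<Omega>}"
  obtain B where B: "\<And>x. x \<in> \<Omega> \<Longrightarrow> norm x \<le> B" using bdd by (auto simp: bounded_iff)
  have "l (B + 1) \<notin> \<Omega>"
  proof
    assume "l (B + 1) \<in> \<Omega>"
    then have "\<bar>l (B + 1) $ i\<bar> \<le> B" using B component_le_norm_cart order_trans by blast
    then show False using assms l_i by simp
  qed
  moreover have "0 \<le> B + 1" using B[OF assms(2)] norm_ge_zero[of p] by linarith
  ultimately have "X \<noteq> {}" by (auto simp: X_def)
  have "closed X"
  proof -
    have "closed (l -` (- \<Omega>))"
      by (intro closed_vimage closed_Compl open_dom cl)
    moreover have "X = {0..} \<inter> l -` (- \<Omega>)" by (auto simp: X_def)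
    ultimately show ?thesis by auto
  qed
  moreover have bX: "bdd_below X" by (auto simp: X_def)
  ultimately have IX: "Inf X \<in> X" using \<open>X \<noteq> {}\<close> closed_contains_Inf by blast
  define t1 where "t1 = Inf X"
  have t1: "l t1 \<notin> \<Omega>" "0 \<le> t1" using IX by (auto simp: X_def t1_def)
  have in\<Omega>: "l t \<in> \<Omega>" if "0 \<le> t" "t < t1" for t
    using that cInf_lower[OF _ bX, of t] by (force simp: X_def t1_def)
  have "l 0 = p" by (simp add: l_def)
  then have "t1 > 0" using t1 assms(2) by (cases "t1 = 0") auto
  then have cl1: "closure {0..<t1} = {0..t1}" by (simp add: closure_atLeastLessThan)
  have icl: "l ` {0..t1} \<subseteq> closure \<Omega>"
  proof -
    have "l ` {0..<t1} \<subseteq> \<Omega>" using in\<Omega> by auto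
    then have "l ` {0..<t1} \<subseteq> closure \<Omega>" using closure_subset by (rule subset_trans)
    from image_closure_subset[OF cl closed_closure this] show ?thesis unfolding cl1 .
  qed
  have "l t1 \<in> closure \<Omega>" using t1(2) by (intro subsetD[OF icl]) simp
  then have "u (l t1) = 0" using t1(1) u_bd closure_dom by blast
  \<comment> \<open>This includes t = t1, where l t itself is on the boundary: since \<mu> > 0 and p
    is beyond the plane, the reflected coordinate is strictly smaller in modulus than that of l t1.
    Hence some s < t1 has l s in \<Omega> with at least that modulus, and axis convexity applies at
    l s.\<close>
  have refl: "set_coord i (2 * \<mu> - l t $ i) (l t) \<in> \<Omega>" if t: "0 \<le> t" "t \<le> t1" for t
  proof -
    define a where "a = \<bar>2 * \<mu> - l t $ i\<bar>"
    have "a < p $ i + t1" using assms t by (auto simp: a_def l_i abs_less_iff)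
    define s where "s = max 0 (a - p $ i)"
    have s: "0 \<le> s" "s < t1" using \<open>a < p $ i + t1\<close> \<open>t1 > 0\<close> by (auto simp: s_def)
    have "set_coord i (2 * \<mu> - l t $ i) (l t) = set_coord i (2 * \<mu> - l t $ i) (l s)"
      by (simp add: vec_eq_iff l_def axis_def)
    moreover have "\<bar>2 * \<mu> - l t $ i\<bar> \<le> \<bar>l s $ i\<bar>"
      unfolding a_def[symmetric] using assms s by (auto simp: l_i s_def)
    ultimately show ?thesis using set_coord_mem[OF in\<Omega>[OF s]] by simp
  qed
  have cw: "continuous_on {0..t1} (\<lambda>t. plane_diff i \<mu> (l t))"
    unfolding plane_diff_def
  proof (intro continuous_on_diff)
    show "continuous_on {0..t1} (\<lambda>t. u (l t))"
      by (rule continuous_on_compose2[OF u_cont cl icl])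
    show "continuous_on {0..t1} (\<lambda>t. u (set_coord i (2 * \<mu> - l t $ i) (l t)))"
    proof (rule continuous_on_compose2[OF u_cont])
      show "continuous_on {0..t1} (\<lambda>t. set_coord i (2 * \<mu> - l t $ i) (l t))"
        unfolding set_coord_def by (intro continuous_intros cl)
      show "(\<lambda>t. set_coord i (2 * \<mu> - l t $ i) (l t)) ` {0..t1} \<subseteq> closure \<Omega>"
        using refl by (auto intro!: subsetD[OF closure_subset])
    qed
  qed
  \<comment> \<open>Z is open by the strong maximum principle and N by continuity, so the connected
    piece of the ray before t1 stays in Z.\<close>
  define Z where "Z = {x \<in> ?D. plane_diff i \<mu> x = 0}"
  define N where "N = {x \<in> ?D. plane_diff i \<mu> x < 0}"
  have "open Z" unfolding Z_def
    by (rule strong_maximum_principle[OF open_cap C(1) _ continuous_on_subset[OF q_cont]]) (use C in auto)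
  have cwD: "continuous_on ?D (plane_diff i \<mu>)" using C1_on_cont[OF C2_onD(1)[OF C(1)]] .
  have "open N"
    using continuous_open_preimage[OF cwD open_cap open_lessThan[of 0]] by (simp add: N_def vimage_def Int_def)
  have "connected (l ` {0..<t1})" by (intro connected_continuous_image cl connected_Ico)
  moreover have lD: "l t \<in> ?D" if "0 \<le> t" "t < t1" for t using in\<Omega>[OF that] that assms by (simp add: l_i)
  have "l ` {0..<t1} \<subseteq> Z \<union> N" using lD C(3) unfolding Z_def N_def by force
  moreover have "Z \<inter> N \<inter> l ` {0..<t1} = {}" by (auto simp: Z_def N_def)
  ultimately have "Z \<inter> l ` {0..<t1} = {} \<or> N \<inter> l ` {0..<t1} = {}"
    using connectedD[OF _ \<open>open Z\<close> \<open>open N\<close>] by blast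
  moreover have "l 0 \<in> Z \<inter> l ` {0..<t1}" using assms p0 \<open>l 0 = p\<close> \<open>t1 > 0\<close> by (auto simp: Z_def)
  ultimately have "N \<inter> l ` {0..<t1} = {}" by blast
  then have z: "plane_diff i \<mu> (l t) = 0" if "t \<in> {0..<t1}" for t
    using \<open>l ` {0..<t1} \<subseteq> Z \<union> N\<close> that by (force simp: Z_def)
  have "plane_diff i \<mu> (l t1) = 0"
    by (rule continuous_constant_on_closure[OF _ z, of "{0..<t1}"]) (use cw cl1 \<open>t1 > 0\<close> in auto)
  then have "u (set_coord i (2 * \<mu> - l t1 $ i) (l t1)) = 0" using \<open>u (l t1) = 0\<close> by (simp add: plane_diff_def)
  moreover have "u (set_coord i (2 * \<mu> - l t1 $ i) (l t1)) > 0" using u_pos refl[of t1] \<open>t1 > 0\<close> by simp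
  ultimately show False by simp
qed

lemma ball_cap:
  fixes x y :: "real^'n"
  assumes "x $ i = \<mu>" "y \<in> ball (x + R *\<^sub>R axis i 1) R"
  shows "y $ i > \<mu>"
proof -
  have "\<bar>(x + R *\<^sub>R axis i 1 - y) $ i\<bar> < R"
    using assms(2) component_le_norm_cart[of "x + R *\<^sub>R axis i 1 - y" i] by (simp add: dist_norm)
  then show ?thesis using assms(1) by (simp add: abs_less_iff)
qed

lemma cball_cap:
  fixes x y :: "real^'n"
  assumes "x $ i = \<mu>" "y \<in> cball (x + R *\<^sub>R axis i 1) R"
  shows "y $ i \<ge> \<mu>"
proof -
  have "\<bar>(x + R *\<^sub>R axis i 1 - y) $ i\<bar> \<le> R"
    using assms(2) component_le_norm_cart[of "x + R *\<^sub>R axis i 1 - y" i] by (simp add: dist_norm)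
  then show ?thesis using assms(1) by (simp add: abs_le_iff)
qed

lemma plane_diff_nonpos:
  assumes "0 < \<mu>" "x \<in> \<Omega>" "x $ i \<ge> \<mu>"
  shows "plane_diff i \<mu> x \<le> 0"
proof (cases "x $ i = \<mu>")
  case True
  then have "set_coord i (2 * \<mu> - x $ i) x = x" by (simp add: vec_eq_iff)
  then show ?thesis by (simp add: plane_diff_def)
next
  case False
  then show ?thesis using cap_strict[OF assms(1,2), of i] assms(3) by simp
qed

lemma plane_diff_axis_eq_0: "x $ i = \<mu> \<Longrightarrow> plane_diff i \<mu> x = 0"
proof -
  assume "x $ i = \<mu>"
  then have "set_coord i (2 * \<mu> - x $ i) x = x" by (simp add: vec_eq_iff)
  then show "plane_diff i \<mu> x = 0" by (simp add: plane_diff_def)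
qed

text \<open>The plane is taken through x itself, \<mu> = \<open>x $ i\<close>. A ball in the cap
  touches the plane at x, where \<open>plane_diff\<close> is zero, and Hopf gives the sign of its
  normal derivative, twice that of u.\<close>

lemma partial_neg:
  assumes x: "x \<in> \<Omega>" "x $ i > 0"
  shows "partial i u x < 0"
proof -
  define \<mu> where "\<mu> = x $ i"
  have "\<mu> > 0" using x by (simp add: \<mu>_def)
  let ?T = "\<lambda>x. set_coord i (2 * \<mu> - x $ i) x"
  define S where "S = \<Omega> \<inter> ?T -` \<Omega>"
  have cT: "continuous_on UNIV ?T" unfolding set_coord_def by (intro continuous_intros)
  have "open S"
    unfolding S_def using open_dom open_vimage[OF open_dom cT] by (rule open_Int)
  have "?T x = x" by (simp add: vec_eq_iff \<mu>_def)
  then have "x \<in> S" using x by (simp add: S_def)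
  then obtain e where e: "e > 0" "cball x e \<subseteq> S"
    using \<open>open S\<close> open_contains_cball by blast
  \<comment> \<open>The touching ball has diameter e and passes through x, hence lies in
    \<open>cball x e\<close>.\<close>
  define R where "R = e / 2"
  have "R > 0" using e by (simp add: R_def)
  let ?y = "x + R *\<^sub>R axis i 1"
  have sub: "cball ?y R \<subseteq> S"
  proof
    fix z assume "z \<in> cball ?y R"
    moreover have "dist x ?y = R" using \<open>R > 0\<close> by (simp add: dist_norm)
    ultimately have "z \<in> cball x e" using dist_triangle[of x z ?y] by (simp add: R_def)
    then show "z \<in> S" using e by blast
  qed
  have S\<Omega>: "S \<subseteq> \<Omega>" by (auto simp: S_def)
  have C2: "C2_on S (plane_diff i \<mu>)"
    by (rule plane_diff_C2[OF \<open>open S\<close> S\<Omega>]) (simp add: S_def)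
  have "grad (plane_diff i \<mu>) x \<bullet> (?y - x) < 0"
  proof (rule hopf_strict[OF C2 \<open>open S\<close> sub \<open>R > 0\<close>])
    show "continuous_on (cball ?y R) q" using q_cont sub S\<Omega> continuous_on_subset by blast
    show "plane_diff i \<mu> z \<le> 0" if "z \<in> cball ?y R" for z
      by (rule plane_diff_nonpos[OF \<open>\<mu> > 0\<close> subsetD[OF subset_trans[OF sub S\<Omega>] that] cball_cap[OF \<mu>_def[symmetric] that]])
    fix z assume z: "z \<in> ball ?y R"
    then have "z \<in> cball ?y R" by simp
    then have z': "z \<in> \<Omega>" "z $ i > \<mu>"
      using subsetD[OF subset_trans[OF sub S\<Omega>]] ball_cap[OF \<mu>_def[symmetric] z] by auto
    show "plane_diff i \<mu> z < 0" using cap_strict[OF \<open>\<mu> > 0\<close> z'] .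
    show "- laplacian (plane_diff i \<mu>) z \<le> q z * plane_diff i \<mu> z" using cap_comparison(2)[OF _ z'] \<open>\<mu> > 0\<close> by simp
  next
    show "dist ?y x = R" using \<open>R > 0\<close> by (simp add: dist_norm)
    show "plane_diff i \<mu> x = 0" by (rule plane_diff_axis_eq_0) (simp add: \<mu>_def)
  qed
  then have "R * partial i (plane_diff i \<mu>) x < 0" by (simp add: inner_axis grad_def)
  then show ?thesis
    using partial_plane_diff[OF C2_onD(1)[OF C2] \<open>x \<in> S\<close> x(1)] \<open>R > 0\<close> by (simp add: \<mu>_def mult_less_0_iff)
qed

lemma partial_sign:
  assumes "x \<in> \<Omega>" "x $ i \<noteq> 0"
  shows "x $ i * partial i u x < 0"
proof (cases "x $ i > 0")
  case True
  then show ?thesis using partial_neg[OF assms(1)] by (simp add: mult_pos_neg)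
next
  case False
  then have "x $ i < 0" using assms by simp
  then show ?thesis
    using partial_neg[OF reflect_mem(1)[OF assms(1)], of i i] partial_reflect[OF assms(1), of i]
    by (simp add: mult_neg_pos)
qed

text \<open>A reflection fixing the k-th axis carries the radial direction p to a coordinate
  direction with index i \<noteq> k. By rotational symmetry the radial derivative at x is
  \<open>partial i u\<close> at A x, whose i-th coordinate is |x'| > 0.\<close>

lemma radial_neg:
  assumes "x \<in> \<Omega>" "xprime k x \<noteq> 0"
  shows "dderiv u (sgn (xprime k x)) x < 0"
proof -
  define p where "p = sgn (xprime k x)"
  have xk: "xprime k x $ k = 0" by (simp add: xprime_def)
  have "\<exists>i. xprime k x $ i \<noteq> 0" using assms(2) by (simp add: vec_eq_iff)
  then obtain i where "i \<noteq> k" using xk by metis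
  let ?e = "axis i 1 :: real^'n"
  have p: "p \<bullet> p = 1" using assms(2) by (simp add: p_def norm_sgn flip: norm_eq_1)
  have pk: "p $ k = 0" using xk by (simp add: p_def sgn_div_norm)
  obtain A :: "real^'n^'n" where A: "orthogonal_matrix A"
    "\<And>x. A *v x = x - (2 * (x \<bullet> (p - ?e)) / ((p - ?e) \<bullet> (p - ?e))) *\<^sub>R (p - ?e)"
    by (rule reflect_along_orthogonal[of "p - ?e"]) auto
  have "(axis k 1 :: real^'n) \<bullet> (p - ?e) = (p - ?e) $ k" by (simp add: inner_axis')
  also have "\<dots> = 0" using pk \<open>i \<noteq> k\<close> by (simp add: axis_def)
  finally have "(axis k 1 :: real^'n) \<bullet> (p - ?e) = 0" .
  then have Ak: "A *v axis k 1 = axis k 1" by (simp add: A(2))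
  have Ap: "A *v p = ?e"
  proof (cases "p = ?e")
    case False
    then have "(p - ?e) \<bullet> (p - ?e) \<noteq> 0" by simp
    moreover have "2 * (p \<bullet> (p - ?e)) = (p - ?e) \<bullet> (p - ?e)"
      using p by (simp add: inner_simps inner_commute inner_axis)
    ultimately show ?thesis unfolding A(2) by simp
  qed (simp add: A(2))
  have inv: "A *v y \<in> \<Omega> \<and> u (A *v y) = u y" if "y \<in> \<Omega>" for y
    using matrix_mem[OF A(1) Ak that] rotation_invariant[OF A(1) Ak that] by simp
  have "dderiv u p x = dderiv u ?e (A *v x)"
    using partial_isometry[OF inv assms(1), of p] Ap by simp
  moreover have "(A *v x) $ i > 0"
  proof -
    have "(A *v x) $ i = (A *v x) \<bullet> (A *v p)" by (simp add: Ap inner_axis)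
    also have "\<dots> = x \<bullet> p" by (rule orthogonal_matrix_inner[OF A(1)])
    also have "\<dots> = (xprime k x + (x $ k) *\<^sub>R axis k 1) \<bullet> p" by (simp add: xprime_def)
    also have "\<dots> = xprime k x \<bullet> p" using pk by (simp add: inner_simps inner_axis')
    also have "\<dots> = norm (xprime k x)"
      using assms(2) by (simp add: p_def sgn_div_norm power2_norm_eq_inner[symmetric] power2_eq_square)
    finally show ?thesis using assms(2) by simp
  qed
  ultimately show ?thesis
    using partial_neg[of "A *v x" i] inv[OF assms(1)] by (simp add: p_def partial_dderiv)
qed

section \<open>The origin as unique, non-degenerate maximum\<close>

lemma zero_mem: "0 \<in> \<Omega>"
  using zero_mem_bound(1) nonempty by blast

text \<open>Evenness of u turns \<open>plane_diff i t z\<close> into u z - u (z - 2 t e), which by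
  the mean value theorem is at most - 2 t c on a ball away from the plane x_i = 0. The Hopf factor G
  depends on R and K but not on t, so \<open>partial i u\<close> at t e is bounded by a negative
  multiple of t.\<close>

lemma second_partial_neg: "partial i (partial i u) 0 < 0"
proof -
  let ?e = "axis i 1 :: real^'n"
  obtain e where e: "e > 0" "cball 0 e \<subseteq> \<Omega>"
    using open_dom zero_mem open_contains_cball by blast
  \<comment> \<open>The Hopf balls lie in the ball of radius 4 R about 0, and reflecting at x_i = t
    adds at most 2 t < R to the norm.\<close>
  define R where "R = e / 5"
  have "R > 0" using e by (simp add: R_def)
  have R5: "x \<in> \<Omega>" if "norm x \<le> 5 * R" for x using that e by (auto simp: R_def)
  have "continuous_on (cball 0 (5 * R)) q"
    by (rule continuous_on_subset[OF q_cont]) (use R5 in auto)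
  then have "bounded (q ` cball 0 (5 * R))"
    by (intro compact_imp_bounded compact_continuous_image) auto
  then obtain K where K: "\<And>x. norm x \<le> 5 * R \<Longrightarrow> \<bar>q x\<bar> \<le> K"
    unfolding bounded_iff by fastforce
  have "K \<ge> 0" using K[of 0] \<open>R > 0\<close> by simp
  \<comment> \<open>Independent of t: it contains the segments from z to z - 2 t e for all z in the
    half balls, as R/2 + t < 7 R/8, and it stays in x_i \<ge> R/8, so \<open>partial i u\<close> has
    a negative maximum -c on it.\<close>
  let ?B = "cball (R *\<^sub>R ?e) (7 * R / 8)"
  have B: "x \<in> \<Omega>" "x $ i > 0" if "x \<in> ?B" for x
  proof -
    have n: "norm (R *\<^sub>R ?e - x) \<le> 7 * R / 8" using that by (simp add: dist_norm)
    have "norm x \<le> norm (R *\<^sub>R ?e) + norm (R *\<^sub>R ?e - x)"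
      using norm_triangle_ineq4[of "R *\<^sub>R ?e" "R *\<^sub>R ?e - x"] by simp
    then show "x \<in> \<Omega>" using n \<open>R > 0\<close> by (intro R5) simp
    have "\<bar>(R *\<^sub>R ?e - x) $ i\<bar> \<le> 7 * R / 8" using n component_le_norm_cart order_trans by blast
    from abs_le_D1[OF this] show "x $ i > 0" using \<open>R > 0\<close> by simp
  qed
  have "continuous_on ?B (partial i u)"
    by (rule continuous_on_subset[OF C1_on_partial[OF u_C1]]) (use B in auto)
  then obtain b where b: "b \<in> ?B" "\<And>x. x \<in> ?B \<Longrightarrow> partial i u x \<le> partial i u b"
    using continuous_attains_sup[OF compact_cball, of "R *\<^sub>R ?e" "7 * R / 8" "partial i u"] \<open>R > 0\<close> by force
  define c where "c = - partial i u b"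
  have "c > 0" using partial_neg[OF B[OF b(1)]] by (simp add: c_def)
  define \<alpha> where "\<alpha> = (2 * CARD('n) + K + 1) / R\<^sup>2 + 1"
  have "\<alpha> > 0" unfolding \<alpha>_def using \<open>K \<ge> 0\<close> \<open>R > 0\<close>
    by (intro add_nonneg_pos divide_nonneg_pos) auto
  define G where "G = 2 * \<alpha> * R\<^sup>2 * exp (- \<alpha> * R\<^sup>2)"
  have "G > 0" using \<open>\<alpha> > 0\<close> \<open>R > 0\<close> by (simp add: G_def)
  have key: "partial i u (t *\<^sub>R ?e) \<le> - (c * G / R) * t" if t: "0 < t" "t < R / 8" for t
  proof -
    define S where "S = ball (0::real^'n) (4 * R)"
    have S\<Omega>: "S \<subseteq> \<Omega>" using R5 \<open>R > 0\<close> by (auto simp: S_def)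
    have "open S" by (simp add: S_def)
    have TS: "set_coord i (2 * t - x $ i) x \<in> \<Omega>" if "x \<in> S" for x
    proof (rule R5)
      have nr: "norm (reflect i x) = norm x"
      proof -
        have "(norm (reflect i x))\<^sup>2 = (norm x)\<^sup>2"
          unfolding norm_sq_sum by (intro sum.cong) auto
        then show ?thesis by simp
      qed
      have "norm (set_coord i (2 * t - x $ i) x) \<le> norm (reflect i x) + norm ((2 * t) *\<^sub>R ?e)"
        unfolding set_coord_reflect by (rule norm_triangle_ineq)
      then show "norm (set_coord i (2 * t - x $ i) x) \<le> 5 * R"
        using that t by (simp add: S_def nr)
    qed
    have C2: "C2_on S (plane_diff i t)" by (rule plane_diff_C2[OF \<open>open S\<close> S\<Omega> TS])
    let ?x = "t *\<^sub>R ?e" and ?y = "t *\<^sub>R ?e + R *\<^sub>R ?e"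
    have dy: "dist 0 ?y \<le> t + R" using t \<open>R > 0\<close> by (simp add: scaleR_add_left[symmetric])
    have sub: "cball ?y R \<subseteq> S"
    proof
      fix z assume "z \<in> cball ?y R"
      then show "z \<in> S" using dist_triangle[of 0 z ?y] dy t unfolding S_def by simp
    qed
    have "?x \<in> S" using t \<open>R > 0\<close> by (simp add: S_def)
    have xi: "?x $ i = t" by simp
    have "grad (plane_diff i t) ?x \<bullet> (?y - ?x) \<le> - (2 * t * c) * G"
      unfolding G_def \<alpha>_def
    proof (rule hopf[OF C2 \<open>open S\<close> sub \<open>R > 0\<close> \<open>K \<ge> 0\<close>])
      show "0 < 2 * t * c" using t \<open>c > 0\<close> by simp
      show "plane_diff i t z \<le> 0" if "z \<in> cball ?y R" for z
        by (rule plane_diff_nonpos[OF t(1) subsetD[OF subset_trans[OF sub S\<Omega>] that] cball_cap[OF xi that]])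
      show "K * plane_diff i t z \<le> laplacian (plane_diff i t) z" if z: "z \<in> ball ?y R" for z
      proof -
        have "z \<in> cball ?y R" using z by simp
        from subsetD[OF sub this] have z': "z \<in> \<Omega>" "z $ i > t" "z \<in> S"
          using S\<Omega> ball_cap[OF xi z] by auto
        have "(K + q z) * plane_diff i t z \<le> 0"
          using K[of z] z' cap_comparison(3)[OF less_imp_le[OF t(1)] z'(1,2)] \<open>R > 0\<close>
          by (intro mult_nonneg_nonpos) (auto simp: abs_le_iff S_def)
        then show ?thesis using cap_comparison(2)[OF less_imp_le[OF t(1)] z'(1,2)] by (simp add: algebra_simps)
      qed
      show "dist ?y ?x = R" using \<open>R > 0\<close> by (simp add: dist_norm)
      show "plane_diff i t ?x = 0" by (rule plane_diff_axis_eq_0) simp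
      fix z assume z: "z \<in> cball ?y (R / 2)"
      have seg: "z + s *\<^sub>R ?e \<in> ?B" if s: "- 2 * t \<le> s" "s \<le> 0" for s
      proof -
        have "R *\<^sub>R ?e - (z + s *\<^sub>R ?e) = (?y - z) + (- t - s) *\<^sub>R ?e" by (simp add: algebra_simps)
        then have "norm (R *\<^sub>R ?e - (z + s *\<^sub>R ?e)) \<le> norm (?y - z) + norm ((- t - s) *\<^sub>R ?e)"
          using norm_triangle_ineq[of "?y - z" "(- t - s) *\<^sub>R ?e"] by (simp only:)
        also have "\<dots> \<le> R / 2 + t" using z s by (auto simp: dist_norm)
        finally show ?thesis using t by (simp add: dist_norm)
      qed
      have "\<exists>s>- 2 * t. s < 0 \<and> u (z + 0 *\<^sub>R ?e) - u (z + (- 2 * t) *\<^sub>R ?e) = (0 - (- 2 * t)) * partial i u (z + s *\<^sub>R ?e)"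
        using t seg B(1) by (intro MVT2 partial_line[OF u_C1]) auto
      then obtain s where s: "- 2 * t < s" "s < 0" "u z - u (z + (- 2 * t) *\<^sub>R ?e) = 2 * t * partial i u (z + s *\<^sub>R ?e)"
        by auto
      have "partial i u (z + s *\<^sub>R ?e) \<le> - c" using b(2)[OF seg] s by (simp add: c_def)
      then have "2 * t * partial i u (z + s *\<^sub>R ?e) \<le> 2 * t * (- c)" using t by (intro mult_left_mono) auto
      moreover have "set_coord i (2 * t - z $ i) z = reflect i (z + (- 2 * t) *\<^sub>R ?e)"
        by (auto simp: vec_eq_iff axis_def)
      then have "plane_diff i t z = u z - u (z + (- 2 * t) *\<^sub>R ?e)"
        unfolding plane_diff_def using reflect_invariant[OF B(1)[OF seg, of "- 2 * t"]] t by simp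
      ultimately show "plane_diff i t z \<le> - (2 * t * c)" using s(3) by simp
    qed
    then have "R * partial i (plane_diff i t) ?x \<le> - (2 * t * c) * G" by (simp add: inner_axis grad_def)
    moreover have "partial i (plane_diff i t) ?x = 2 * partial i u ?x"
      using partial_plane_diff[OF C2_onD(1)[OF C2] \<open>?x \<in> S\<close>] S\<Omega> \<open>?x \<in> S\<close> by auto
    ultimately show ?thesis using \<open>R > 0\<close> by (simp add: field_simps)
  qed
  \<comment> \<open>Both sides of \<open>key\<close> vanish at t = 0, so the linear bound passes to
    the derivative.\<close>
  have "partial i (partial i u) 0 \<le> - (c * G / R)"
  proof (rule derivative_le_at_0)
    show "((\<lambda>t. partial i u (0 + t *\<^sub>R ?e)) has_real_derivative partial i (partial i u) 0) (at 0)"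
      using partial_line[OF C2_onD(2)[OF u_reg], of 0 0 i i] zero_mem by simp
    show "((\<lambda>t. - (c * G / R) * t) has_real_derivative - (c * G / R)) (at 0)"
      using DERIV_cmult_Id by blast
    show "partial i u (0 + 0 *\<^sub>R ?e) = - (c * G / R) * 0" using partial_zero[OF zero_mem] by simp
    show "R / 8 > 0" using \<open>R > 0\<close> by simp
  qed (use key in simp)
  also have "\<dots> < 0" using \<open>c > 0\<close> \<open>G > 0\<close> \<open>R > 0\<close> by simp
  finally show ?thesis .
qed

text \<open>By symmetry \<open>partial j u\<close> vanishes on the hyperplane x_j = 0, which
  contains the i-th axis.\<close>

lemma mixed_partial_zero:
  assumes "i \<noteq> j" shows "partial i (partial j u) 0 = 0"
proof -
  let ?e = "axis i 1 :: real^'n"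
  have "((\<lambda>t. partial j u (0 + t *\<^sub>R ?e)) has_real_derivative partial i (partial j u) 0) (at 0)"
    using partial_line[OF C2_onD(2)[OF u_reg], of 0 0 i j] zero_mem by simp
  moreover have "((\<lambda>t. partial j u (0 + t *\<^sub>R ?e)) has_real_derivative 0) (at 0)"
  proof -
    obtain e where e: "e > 0" "ball 0 e \<subseteq> \<Omega>"
      using open_dom zero_mem open_contains_ball by blast
    have "((\<lambda>t. 0) has_real_derivative 0) (at (0::real))" by simp
    then show ?thesis
    proof (rule has_field_derivative_transform_within_open[of _ _ _ "ball 0 e"])
      fix t :: real assume "t \<in> ball 0 e"
      then have "t *\<^sub>R ?e \<in> \<Omega>" using e by (auto simp: dist_norm)
      then show "0 = partial j u (0 + t *\<^sub>R ?e)" using partial_zero[of "t *\<^sub>R ?e" j] assms by (simp add: axis_def)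
    qed (use e in auto)
  qed
  ultimately show ?thesis by (rule DERIV_unique)
qed

lemma critical_point:
  assumes "x \<in> \<Omega>" "\<forall>i. partial i u x = 0"
  shows "x = 0"
proof -
  have "x $ i = 0" for i using partial_sign[OF assms(1), of i] assms(2) by force
  then show ?thesis by (simp add: vec_eq_iff)
qed

text \<open>A maximum over the compact closure is positive, hence interior, hence critical, hence at
  the origin.\<close>

lemma zero_max:
  assumes "x \<in> \<Omega>" shows "u x \<le> u 0"
proof -
  have "compact (closure \<Omega>)" using bdd by (simp add: compact_closure)
  moreover have "closure \<Omega> \<noteq> {}" using nonempty by simp
  ultimately obtain p where p: "p \<in> closure \<Omega>" "\<And>y. y \<in> closure \<Omega> \<Longrightarrow> u y \<le> u p"
    using continuous_attains_sup[OF _ _ u_cont] by blast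
  have le: "u y \<le> u p" if "y \<in> \<Omega>" for y using p(2) closure_subset that by blast
  have "u p > 0" using le[OF zero_mem] u_pos zero_mem by force
  then have "p \<in> \<Omega>" using p(1) u_bd closure_dom by force
  have "(\<lambda>h. grad u p \<bullet> h) = (\<lambda>h. 0)"
    using differential_zero_maxmin[OF \<open>p \<in> \<Omega>\<close> open_dom C1_on_deriv[OF u_C1 \<open>p \<in> \<Omega>\<close>]] le by blast
  then have "grad u p \<bullet> axis i 1 = 0" for i by metis
  then have "\<forall>i. partial i u p = 0" by (simp add: inner_axis grad_def)
  then have "p = 0" using critical_point \<open>p \<in> \<Omega>\<close> by blast
  then show ?thesis using le[OF assms] by simp
qed

lemma hessian_nondegenerate: "det (hessian u 0) \<noteq> 0"
proof -
  have "det (hessian u 0) = (\<Prod>i\<in>UNIV. hessian u 0 $ i $ i)"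
    by (rule det_diagonal) (simp add: hessian_def mixed_partial_zero)
  moreover have "hessian u 0 $ i $ i \<noteq> 0" for i
    using second_partial_neg[of i] by (simp add: hessian_def)
  ultimately show ?thesis by simp
qed

end

theorem theorem1p1:
  fixes \<Omega> :: "(real^'n::finite) set" and k :: 'n
    and f :: "real^'n \<Rightarrow> real \<Rightarrow> real" and u :: "real^'n \<Rightarrow> real"
  assumes n3: "CARD('n) \<ge> 3"
    and dom: "domain \<Omega>" and bdd: "bounded \<Omega>"
    and srs: "simple_rot_sym k \<Omega>"
    and f_reg: "C11_on (\<Omega> \<times> UNIV) (\<lambda>(x, s). f x s)"
    and f_conv: "\<forall>x\<in>\<Omega>. convex_on UNIV (f x)"
    and f_even: "\<forall>x\<in>\<Omega>. \<forall>s. f (reflect k x) s = f x s"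
    and f_rad: "\<forall>x\<in>\<Omega>. \<forall>y\<in>\<Omega>. \<forall>s. y $ k = x $ k \<and> norm (xprime k y) = norm (xprime k x)
                  \<longrightarrow> f y s = f x s"
    and f_decr: "\<forall>i. \<forall>x a c s. x $ i = 0 \<and> 0 < a \<and> a \<le> c \<and>
                  x + a *\<^sub>R axis i 1 \<in> \<Omega> \<and> x + c *\<^sub>R axis i 1 \<in> \<Omega>
                  \<longrightarrow> f (x + c *\<^sub>R axis i 1) s \<le> f (x + a *\<^sub>R axis i 1) s"
    and u_reg: "C2_on \<Omega> u" and u_cont: "continuous_on (closure \<Omega>) u"
    and u_eq: "\<forall>x\<in>\<Omega>. - laplacian u x = f x (u x)"
    and u_bd: "\<forall>x\<in>frontier \<Omega>. u x = 0"
    and u_pos: "\<forall>x\<in>\<Omega>. u x > 0"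
    and u_stable: "stable \<Omega> f u"
  shows "(\<forall>A::real^'n^'n. orthogonal_matrix A \<and> A *v axis k 1 = axis k 1 \<longrightarrow>
            (\<forall>x\<in>\<Omega>. u (A *v x) = u x))
       \<and> (\<forall>x\<in>\<Omega>. x $ k > 0 \<longrightarrow> partial k u x < 0)
       \<and> (\<forall>i. i \<noteq> k \<longrightarrow> (\<forall>x\<in>\<Omega>. x $ i \<noteq> 0 \<longrightarrow> x $ i * partial i u x < 0))
       \<and> (\<forall>x\<in>\<Omega>. xprime k x \<noteq> 0 \<longrightarrow> dderiv u (sgn (xprime k x)) x < 0)
       \<and> (\<exists>p\<in>\<Omega>. (\<forall>i. partial i u p = 0)
              \<and> (\<forall>x\<in>\<Omega>. (\<forall>i. partial i u x = 0) \<longrightarrow> x = p)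
              \<and> (\<forall>x\<in>\<Omega>. u x \<le> u p)
              \<and> det (hessian u p) \<noteq> 0)"
proof -
  interpret stable_solution \<Omega> k f u
    by unfold_locales (fact dom bdd srs f_reg f_conv f_even f_rad f_decr u_reg u_cont u_eq u_bd u_pos u_stable)+
  show ?thesis
  proof (intro conjI)
    show "\<forall>A::real^'n^'n. orthogonal_matrix A \<and> A *v axis k 1 = axis k 1 \<longrightarrow> (\<forall>x\<in>\<Omega>. u (A *v x) = u x)"
      using rotation_invariant by blast
    show "\<forall>x\<in>\<Omega>. x $ k > 0 \<longrightarrow> partial k u x < 0"
      using partial_neg by blast
    show "\<forall>i. i \<noteq> k \<longrightarrow> (\<forall>x\<in>\<Omega>. x $ i \<noteq> 0 \<longrightarrow> x $ i * partial i u x < 0)"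
      using partial_sign by blast
    show "\<forall>x\<in>\<Omega>. xprime k x \<noteq> 0 \<longrightarrow> dderiv u (sgn (xprime k x)) x < 0"
      using radial_neg by blast
    show "\<exists>p\<in>\<Omega>. (\<forall>i. partial i u p = 0) \<and> (\<forall>x\<in>\<Omega>. (\<forall>i. partial i u x = 0) \<longrightarrow> x = p)
        \<and> (\<forall>x\<in>\<Omega>. u x \<le> u p) \<and> det (hessian u p) \<noteq> 0"
      using zero_mem partial_zero[OF zero_mem] critical_point zero_max hessian_nondegenerate
      by (intro bexI[of _ 0]) auto
  qed
qed

end
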